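(* Let $f,g\in\mathbb{C}\{x,y\}$ be relatively prime, vanishing at the origin, such that the foliation $\mathcal{F}_{\omega_{f/g}}$ defined by $\omega_{f/g}=g\,df-f\,dg$ has an isolated singularity at $0\in\mathbb{C}^2$. Let $h_1,\dots,h_r$ be the bifurcation fibers of the pencil generated by $f$ and $g$, let $\varphi_1,\dots,\varphi_r$ be generic fibers of this pencil, and assume that $f$ and $g$ are also generic fibers, with $f,g,\varphi_1,\dots,\varphi_r$ pairwise distinct as members of the pencil. Then $$\tau(\mathcal{F}_{\omega_{f/g}},\mathcal{B}_0)-\tau(\mathcal{F}_{\omega_{f/g}},\mathcal{B}_\infty)=\tau(fg)+\sum_{j=1}^r\bigl(\tau(h_j)-\tau(\varphi_j)\bigr)-2r\,I_0(f,g)+\Theta_{\mathcal{B}_0}+\Theta_{h_1\cdots h_r}-\Theta_{\mathcal{B}_\infty},$$ where $\mathcal{B}_0=fgh_1\cdots h_r$ and $\mathcal{B}_\infty=\varphi_1\cdots\varphi_r$.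
   Context: $\mathcal{O}_2=\mathbb{C}\{x,y\}$; $I_0(f,g)=\dim_{\mathbb{C}}\mathcal{O}_2/(f,g)$. For a reduced $h\in\mathcal{O}_2$, $\tau(h)=\dim_{\mathbb{C}}\mathcal{O}_2/(h,h_x,h_y)$. Under the isolated singularity assumption all members $C_{[\alpha:\beta]}:\alpha f+\beta g=0$ of the pencil are reduced, and they are $\mathcal{F}_{\omega_{f/g}}$-invariant. For a reduced invariant curve $h=0$, $\tau(\mathcal{F}_{\omega_{f/g}},h):=\dim_{\mathbb{C}}\mathcal{O}_2/(gf_x-fg_x,\,gf_y-fg_y,\,h)$. Let $\tau_{gen}=\min_{[\alpha:\beta]\in\mathbb{P}^1}\tau(C_{[\alpha:\beta]})$. The set $\mathcal{B}(f,g)=\{[\alpha:\beta]\in\mathbb{P}^1:\tau(C_{[\alpha:\beta]})>\tau_{gen}\}$ is finite; its members are the bifurcation fibers (one equation $h_i=\alpha_if+\beta_ig$ for each element, so $r=|\mathcal{B}(f,g)|$), and the other members of the pencil are the generic fibers. For pairwise coprime reduced $f_1,\dots,f_k$, the number $\Theta$ attached to the factorization $f_1\cdots f_k$ is determined by $\tau(f_1\cdots f_k)=\sum_{j=1}^k\tau(f_j)+\sum_{1\le i<j\le k}I_0(f_i,f_j)+\Theta_{f_1\cdots f_k}$. $\Theta_{h_1\cdots h_r}$ and $\Theta_{\mathcal{B}_\infty}=\Theta_{\varphi_1\cdots\varphi_r}$ are taken with respect to the $r$ displayed factors, while $\Theta_{\mathcal{B}_0}$ is taken with respect to the two factors $fg$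 and $h_1\cdots h_r$, i.e. $\tau(fgh_1\cdots h_r)=\tau(fg)+\tau(h_1\cdots h_r)+I_0(fg,h_1\cdots h_r)+\Theta_{\mathcal{B}_0}$. For $r=0$ empty products are $1$, with $\tau(1)=0$ and $\Theta=0$. *)

theory Defs
  imports
    "HOL-Analysis.Analysis"
    "HOL-Computational_Algebra.Formal_Power_Series"
    "HOL-Algebra.QuotRing"
    "HOL-Algebra.Embedded_Algebras"
    "HOL-Algebra.Algebraic_Closure_Type"
begin

section \<open>The ring of convergent power series in two variables\<close>

text \<open>A power series in \<open>x, y\<close> is an element of \<open>complex fps fps\<close>: the outer index is
  the exponent of \<open>x\<close>, the inner one the exponent of \<open>y\<close>.\<close>

definition cf :: "complex fps fps \<Rightarrow> nat \<Rightarrow> nat \<Rightarrow> complex" where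
  "cf F i j = fps_nth (fps_nth F i) j"

definition convergent2 :: "complex fps fps \<Rightarrow> bool" where
  "convergent2 F \<longleftrightarrow>
     (\<exists>\<rho>>0. (\<lambda>(i, j). norm (cf F i j) * \<rho> ^ i * \<rho> ^ j) summable_on (UNIV :: (nat \<times> nat) set))"

lemma convergent2_bound:
  assumes "convergent2 F"
  obtains C R where "C \<ge> 0" "R \<ge> 1" "\<And>i j. norm (cf F i j) \<le> C * R ^ (i + j)"
proof -
  obtain \<rho> :: real where \<rho>: "\<rho> > 0"
    and s: "(\<lambda>(i, j). norm (cf F i j) * \<rho> ^ i * \<rho> ^ j) summable_on (UNIV :: (nat \<times> nat) set)"
    using assms by (auto simp: convergent2_def)
  define C where "C = (\<Sum>\<^sub>\<infinity>(i, j). norm (cf F i j) * \<rho> ^ i * \<rho> ^ j)"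
  have le: "norm (cf F i j) * \<rho> ^ (i + j) \<le> C" for i j
  proof -
    have "(\<Sum>(i, j)\<in>{(i, j)}. norm (cf F i j) * \<rho> ^ i * \<rho> ^ j) \<le> C"
      unfolding C_def using \<rho> by (intro finite_sum_le_infsum[OF s]) auto
    then show ?thesis by (simp add: power_add mult.assoc)
  qed
  have C0: "C \<ge> 0" using order.trans[OF _ le[of 0 0], of 0] by simp
  have "norm (cf F i j) \<le> C * (max 1 (1 / \<rho>)) ^ (i + j)" for i j
  proof -
    have "norm (cf F i j) \<le> C * (1 / \<rho>) ^ (i + j)"
      using le[of i j] \<rho> by (simp add: field_simps)
    also have "\<dots> \<le> C * (max 1 (1 / \<rho>)) ^ (i + j)"
      using C0 \<rho> by (intro mult_left_mono power_mono) auto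
    finally show ?thesis .
  qed
  then show thesis using that[of C "max 1 (1 / \<rho>)"] C0 by auto
qed

lemma convergent2I:
  assumes R: "R \<ge> 1" and b: "\<And>i j. norm (cf F i j) \<le> C * R ^ (i + j)"
  shows "convergent2 F"
proof -
  have C0: "C \<ge> 0" using order.trans[OF norm_ge_zero b[of 0 0]] by simp
  define \<rho> where "\<rho> = 1 / (2 * R)"
  have \<rho>: "\<rho> > 0" using R by (simp add: \<rho>_def)
  have g: "(\<lambda>i. (1 / 2 :: real) ^ i) summable_on (UNIV :: nat set)"
    by (intro summable_nonneg_imp_summable_on summable_geometric) auto
  have "(\<lambda>(i, j). (1 / 2 :: real) ^ i * (1 / 2) ^ j) summable_on
      ((UNIV :: nat set) \<times> (UNIV :: nat set))"
  proof (rule summable_on_SigmaI)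
    show "((\<lambda>j. case (i, j) of (i, j) \<Rightarrow> (1 / 2 :: real) ^ i * (1 / 2) ^ j) has_sum
        (1 / 2) ^ i * (\<Sum>\<^sub>\<infinity>j. (1 / 2) ^ j)) UNIV" for i :: nat
      using has_sum_cmult_right[OF has_sum_infsum[OF g], of "(1 / 2) ^ i"] by simp
  qed (use g in \<open>auto intro: summable_on_cmult_left\<close>)
  then have "(\<lambda>p. C * (case p of (i, j) \<Rightarrow> (1 / 2 :: real) ^ i * (1 / 2) ^ j)) summable_on
      (UNIV :: (nat \<times> nat) set)"
    by (intro summable_on_cmult_right) simp
  then have "(\<lambda>(i, j). norm (cf F i j) * \<rho> ^ i * \<rho> ^ j) summable_on (UNIV :: (nat \<times> nat) set)"
  proof (rule summable_on_comparison_test)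
    fix p :: "nat \<times> nat"
    obtain i j where p: "p = (i, j)" by fastforce
    have "norm (cf F i j) * \<rho> ^ (i + j) \<le> (C * R ^ (i + j)) * \<rho> ^ (i + j)"
      using b[of i j] \<rho> by (intro mult_right_mono) auto
    also have "\<dots> = C * (1 / 2) ^ (i + j)"
      using R by (simp add: \<rho>_def power_divide power_mult_distrib)
    finally show "(case p of (i, j) \<Rightarrow> norm (cf F i j) * \<rho> ^ i * \<rho> ^ j)
        \<le> C * (case p of (i, j) \<Rightarrow> (1 / 2) ^ i * (1 / 2) ^ j)"
      by (simp add: p power_add mult.assoc)
    show "0 \<le> (case p of (i, j) \<Rightarrow> norm (cf F i j) * \<rho> ^ i * \<rho> ^ j)"
      using \<rho> by (simp add: p)
  qed
  then show ?thesis using \<rho> by (auto simp: convergent2_def)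
qed

lemma convergent2_const: "convergent2 (fps_const (fps_const c))"
  by (rule convergent2I[where R = 1 and C = "norm c"]) (auto simp: cf_def)

lemma convergent2_add:
  assumes "convergent2 F" "convergent2 G"
  shows "convergent2 (F + G)"
proof -
  obtain C R where F: "C \<ge> 0" "R \<ge> 1" "\<And>i j. norm (cf F i j) \<le> C * R ^ (i + j)"
    using convergent2_bound[OF assms(1)] by blast
  obtain D S where G: "D \<ge> 0" "S \<ge> 1" "\<And>i j. norm (cf G i j) \<le> D * S ^ (i + j)"
    using convergent2_bound[OF assms(2)] by blast
  show ?thesis
  proof (rule convergent2I[where R = "max R S" and C = "C + D"])
    fix i j
    have "norm (cf (F + G) i j) \<le> norm (cf F i j) + norm (cf G i j)"
      by (simp add: cf_def norm_triangle_ineq)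
    also have "\<dots> \<le> C * R ^ (i + j) + D * S ^ (i + j)"
      using F(3) G(3) by (intro add_mono) auto
    also have "\<dots> \<le> C * (max R S) ^ (i + j) + D * (max R S) ^ (i + j)"
      using F G by (intro add_mono mult_left_mono power_mono) auto
    finally show "norm (cf (F + G) i j) \<le> (C + D) * max R S ^ (i + j)"
      by (simp add: algebra_simps)
  qed (use F in auto)
qed

lemma convergent2_uminus: "convergent2 F \<Longrightarrow> convergent2 (- F)"
  by (simp add: convergent2_def cf_def)

lemma convergent2_mult:
  assumes "convergent2 F" "convergent2 G"
  shows "convergent2 (F * G)"
proof -
  obtain C R where F: "C \<ge> 0" "R \<ge> 1" "\<And>i j. norm (cf F i j) \<le> C * R ^ (i + j)"
    using convergent2_bound[OF assms(1)] by blast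
  obtain D S where G: "D \<ge> 0" "S \<ge> 1" "\<And>i j. norm (cf G i j) \<le> D * S ^ (i + j)"
    using convergent2_bound[OF assms(2)] by blast
  define T where "T = max R S"
  have T: "T \<ge> 1" using F by (auto simp: T_def)
  show ?thesis
  proof (rule convergent2I[where R = "2 * T" and C = "C * D"])
    fix i j
    have eq: "cf (F * G) i j = (\<Sum>k=0..i. \<Sum>l=0..j. cf F k l * cf G (i - k) (j - l))"
      by (simp add: cf_def fps_mult_nth fps_sum_nth)
    have term_le: "norm (cf F k l * cf G (i - k) (j - l)) \<le> C * D * T ^ (i + j)"
      if "k \<le> i" "l \<le> j" for k l
    proof -
      have "norm (cf F k l) \<le> C * T ^ (k + l)"
        using F(3)[of k l] mult_left_mono[OF power_mono[of R T "k + l"], of C] F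
        by (auto simp: T_def intro: order.trans)
      moreover have "norm (cf G (i - k) (j - l)) \<le> D * T ^ (i - k + (j - l))"
        using G(3)[of "i - k" "j - l"] mult_left_mono[OF power_mono[of S T "i - k + (j - l)"], of D] G
        by (auto simp: T_def intro: order.trans)
      ultimately have "norm (cf F k l) * norm (cf G (i - k) (j - l)) \<le>
          (C * T ^ (k + l)) * (D * T ^ (i - k + (j - l)))"
        using F T by (intro mult_mono) auto
      also have "\<dots> = C * D * T ^ (k + l + (i - k + (j - l)))"
        by (simp only: power_add ac_simps)
      also have "k + l + (i - k + (j - l)) = i + j" using that by simp
      finally show ?thesis by (simp add: norm_mult)
    qed
    have "norm (cf (F * G) i j) \<le> (\<Sum>k=0..i. \<Sum>l=0..j. C * D * T ^ (i + j))"
      unfolding eq by (intro sum_norm_le order.trans[OF norm_sum] sum_mono term_le) auto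
    also have "\<dots> = real (Suc i) * real (Suc j) * (C * D * T ^ (i + j))"
      by simp
    also have "\<dots> \<le> 2 ^ i * 2 ^ j * (C * D * T ^ (i + j))"
    proof -
      have *: "real (Suc n) \<le> 2 ^ n" for n
        by (metis Suc_leI less_exp of_nat_le_iff of_nat_numeral of_nat_power)
      show ?thesis using * F G T by (intro mult_right_mono mult_mono) auto
    qed
    finally show "norm (cf (F * G) i j) \<le> C * D * (2 * T) ^ (i + j)"
      by (simp add: power_add power_mult_distrib algebra_simps)
  qed (use T in auto)
qed

definition dx :: "complex fps fps \<Rightarrow> complex fps fps" where
  "dx F = fps_deriv F"

definition dy :: "complex fps fps \<Rightarrow> complex fps fps" where
  "dy F = Abs_fps (\<lambda>i. fps_deriv (fps_nth F i))"

lemma convergent2_deriv: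
  assumes "convergent2 F"
  shows "convergent2 (dx F)" "convergent2 (dy F)"
proof -
  obtain C R where F: "C \<ge> 0" "R \<ge> 1" "\<And>i j. norm (cf F i j) \<le> C * R ^ (i + j)"
    using convergent2_bound[OF assms] by blast
  have *: "real (Suc n) \<le> 2 ^ (n + m)" for n m
  proof -
    have "real (Suc n) \<le> 2 ^ n"
      by (metis Suc_leI less_exp of_nat_le_iff of_nat_numeral of_nat_power)
    also have "\<dots> \<le> 2 ^ (n + m)" by (rule power_increasing) auto
    finally show ?thesis .
  qed
  have main: "real (Suc n) * norm (cf F i' j') \<le> C * R * (2 * R) ^ (i + j)"
    if "i' + j' = Suc (i + j)" "n \<le> i + j" for i j i' j' n
  proof -
    have "real (Suc n) * norm (cf F i' j') \<le> 2 ^ (i + j) * (C * R ^ (i' + j'))"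
      using F(3)[of i' j'] F(1,2) *[of n "i + j - n"] that by (intro mult_mono) auto
    then show ?thesis using that by (simp add: power_mult_distrib algebra_simps)
  qed
  have nS: "norm (1 + of_nat n :: complex) = real (Suc n)" for n
    by (metis norm_of_nat of_nat_Suc)
  have cfx: "cf (dx F) i j = of_nat (Suc i) * cf F (Suc i) j" for i j
  proof -
    have "fps_nth (of_nat (Suc i) * G) j = of_nat (Suc i) * fps_nth G j" for G :: "complex fps"
      by (metis fps_mult_left_const_nth fps_of_nat)
    then show ?thesis by (simp add: cf_def dx_def del: of_nat_Suc)
  qed
  have cfy: "cf (dy F) i j = of_nat (Suc j) * cf F i (Suc j)" for i j
    by (simp add: cf_def dy_def)
  show "convergent2 (dx F)"
    by (rule convergent2I[where R = "2 * R" and C = "C * R"])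
      (use F main in \<open>auto simp: cfx norm_mult nS simp del: of_nat_Suc\<close>)
  show "convergent2 (dy F)"
    by (rule convergent2I[where R = "2 * R" and C = "C * R"])
      (use F main in \<open>auto simp: cfy norm_mult nS simp del: of_nat_Suc\<close>)
qed

typedef conv2 = "{F. convergent2 F}"
  morphisms series Conv2
  using convergent2_const by blast

setup_lifting type_definition_conv2

instantiation conv2 :: idom
begin

lift_definition zero_conv2 :: conv2 is 0
  using convergent2_const[of 0] by simp

lift_definition one_conv2 :: conv2 is 1
  using convergent2_const[of 1] by simp

lift_definition plus_conv2 :: "conv2 \<Rightarrow> conv2 \<Rightarrow> conv2" is "(+)"
  by (rule convergent2_add)

lift_definition uminus_conv2 :: "conv2 \<Rightarrow> conv2" is "uminus"
  by (rule convergent2_uminus)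

lift_definition minus_conv2 :: "conv2 \<Rightarrow> conv2 \<Rightarrow> conv2" is "(-)"
  unfolding diff_conv_add_uminus by (intro convergent2_add convergent2_uminus)

lift_definition times_conv2 :: "conv2 \<Rightarrow> conv2 \<Rightarrow> conv2" is "(*)"
  by (rule convergent2_mult)

instance
  by standard (transfer; simp add: algebra_simps)+

end

text \<open>The division only serves to make the library notion \<^const>\<open>coprime\<close> (every common
  divisor is a unit) available; the value for a divisor which does not divide is irrelevant.\<close>

instantiation conv2 :: idom_divide
begin

definition divide_conv2 :: "conv2 \<Rightarrow> conv2 \<Rightarrow> conv2" where
  "divide_conv2 a b = (if b = 0 then 0 else if b dvd a then (THE c. a = c * b) else 0)"

instance
  by standard (auto simp: divide_conv2_def)

end

instance conv2 :: algebraic_semidom ..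

lift_definition const2 :: "complex \<Rightarrow> conv2" is "\<lambda>c. fps_const (fps_const c)"
  by (rule convergent2_const)

lift_definition deriv_x :: "conv2 \<Rightarrow> conv2" is dx
  by (rule convergent2_deriv)

lift_definition deriv_y :: "conv2 \<Rightarrow> conv2" is dy
  by (rule convergent2_deriv)

text \<open>The value at a point near the origin. Since \<^const>\<open>infsum\<close> is \<open>0\<close> for families that are
  not summable, this is meaningful only on a sufficiently small neighbourhood of \<open>(0, 0)\<close>.\<close>

definition eval2 :: "conv2 \<Rightarrow> complex \<times> complex \<Rightarrow> complex" where
  "eval2 F p = (\<Sum>\<^sub>\<infinity>(i, j). cf (series F) i j * fst p ^ i * snd p ^ j)"


section \<open>Local invariants\<close>

text \<open>\<open>qdim S\<close> is the dimension over the complex numbers of the quotient of the ring of convergent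
  power series by the ideal generated by \<open>S\<close>; the scalars are the classes of the constant series.
  As everywhere with \<^const>\<open>ring.dim\<close>, the value is meaningful if the dimension is finite, which is
  the case for all quotients considered below when the pencil has an isolated singularity.\<close>

definition O2 :: "conv2 ring" where
  "O2 = ring_of_type_algebra"

definition qdim :: "conv2 set \<Rightarrow> nat" where
  "qdim S = (let I = genideal O2 S; Q = O2 Quot I; K = range (\<lambda>c. I +>\<^bsub>O2\<^esub> const2 c)
     in ring.dim Q K (carrier Q))"

definition intersection_number :: "conv2 \<Rightarrow> conv2 \<Rightarrow> nat" where
  "intersection_number f g = qdim {f, g}"

definition tjurina :: "conv2 \<Rightarrow> nat" where
  "tjurina h = qdim {h, deriv_x h, deriv_y h}"

text \<open>The coefficients of \<open>g df - f dg\<close>.\<close>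

definition omega_x :: "conv2 \<Rightarrow> conv2 \<Rightarrow> conv2" where
  "omega_x f g = g * deriv_x f - f * deriv_x g"

definition omega_y :: "conv2 \<Rightarrow> conv2 \<Rightarrow> conv2" where
  "omega_y f g = g * deriv_y f - f * deriv_y g"

text \<open>The origin is an isolated common zero of the coefficients of \<open>A dx + B dy\<close>. Common factors of
  \<open>A\<close> and \<open>B\<close> are not divided out first.\<close>

definition isolated_singularity_form :: "conv2 \<Rightarrow> conv2 \<Rightarrow> bool" where
  "isolated_singularity_form A B \<longleftrightarrow>
     eval2 A (0, 0) = 0 \<and> eval2 B (0, 0) = 0 \<and>
     (\<forall>\<^sub>F p in at (0, 0). \<not> (eval2 A p = 0 \<and> eval2 B p = 0))"

definition tjurina_foliation :: "conv2 \<Rightarrow> conv2 \<Rightarrow> conv2 \<Rightarrow> nat" where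
  "tjurina_foliation f g h = qdim {omega_x f g, omega_y f g, h}"

definition Theta :: "conv2 list \<Rightarrow> int" where
  "Theta fs = int (tjurina (prod_list fs))
     - (\<Sum>j<length fs. int (tjurina (fs ! j)))
     - (\<Sum>j<length fs. \<Sum>i<j. int (intersection_number (fs ! i) (fs ! j)))"


section \<open>Pencils\<close>

definition proj_rel :: "((complex \<times> complex) \<times> (complex \<times> complex)) set" where
  "proj_rel = {((a, b), (c, d)). (a, b) \<noteq> (0, 0) \<and> (\<exists>t. t \<noteq> 0 \<and> c = t * a \<and> d = t * b)}"

text \<open>The point \<open>[a : b]\<close> of the projective line; only used for \<open>(a, b) \<noteq> (0, 0)\<close>.\<close>

definition proj_pt :: "complex \<Rightarrow> complex \<Rightarrow> (complex \<times> complex) set" where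
  "proj_pt a b = proj_rel `` {(a, b)}"

definition pencil_member :: "conv2 \<Rightarrow> conv2 \<Rightarrow> complex \<Rightarrow> complex \<Rightarrow> conv2" where
  "pencil_member f g a b = const2 a * f + const2 b * g"

definition tau_gen :: "conv2 \<Rightarrow> conv2 \<Rightarrow> nat" where
  "tau_gen f g = (INF (a, b) \<in> - {(0, 0)}. tjurina (pencil_member f g a b))"

definition bifurcation_set :: "conv2 \<Rightarrow> conv2 \<Rightarrow> (complex \<times> complex) set set" where
  "bifurcation_set f g =
     {proj_pt a b | a b. (a, b) \<noteq> (0, 0) \<and> tjurina (pencil_member f g a b) > tau_gen f g}"

end

(* Write \<omega> = g df - f dg, let p_1, ..., p_k be pairwise distinct members of the pencil, P their product,
   and I the intersection number of f and g. Unfolding every \<Theta> and using that any two distinct members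
   meet with multiplicity I, the claim becomes the case k = r + 2 minus the case k = r of
     \<tau>(F, P) - \<tau>(P) = - k (k - 2) I.
   To see this choose a member l of the pencil not proportional to any p_i. Then l dP = G \<omega> + k P dl,
   where G is the derivative of P in the direction of the pencil given by l, so that G is
   a nonzero constant times the product of the p_j, j \<noteq> i, modulo p_i. Hence the ideals l (P_x, P_y) and
   G (\<omega>_x, \<omega>_y) agree modulo P, and since l and G are nonzerodivisors modulo P, comparing
   colengths gives \<tau>(P) + I(P, l) = \<tau>(F, P) + I(P, G) with I(P, l) = k I and I(P, G) = k (k - 1) I.
   All colengths are finite because (\<omega>_x, \<omega>_y) contains powers of x and y; this is the Nullstellensatz for
   two series, which follows from Weierstrass division. *)

theory Submission
  imports Defs
begin

section \<open>Relative dimension and quotient rings\<close>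

text \<open>The hypothesis is analytic, a statement about values near the origin, whereas every
  invariant is the dimension of a quotient ring and carries information only once it is known to be
  finite. The bridge is the condition that an ideal contains powers of x and y
  (\<open>primary2\<close>). It survives products and enlarging the ideal, it yields finite
  colength, and it makes each of two generators a nonzerodivisor modulo the other, so one notion
  does the work of dimension theory and of depth. Dimensions are counted by chains of
  one-dimensional extensions between complex subspaces of the single ring of convergent series
  (\<open>reldim\<close>). An exact sequence then becomes an operation on chains, and only one lemma
  has to compare a chain with an actual quotient ring.\<close>

lemma cf_series_eqI: "(\<And>i j. cf (series F) i j = cf (series G) i j) \<Longrightarrow> F = G"
  by (metis cf_def fps_ext series_inject)

lemma const2_simps [simp]:
  "const2 0 = 0" "const2 1 = 1"
  by (transfer, simp)+

lemma const2_add: "const2 (a + b) = const2 a + const2 b"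
  by transfer simp

lemma const2_mult: "const2 (a * b) = const2 a * const2 b"
  by transfer simp

lemma const2_minus: "const2 (- a) = - const2 a"
  by transfer simp

lemma const2_diff: "const2 (a - b) = const2 a - const2 b"
  by transfer simp

lemma const2_inverse: "c \<noteq> 0 \<Longrightarrow> const2 (inverse c) * const2 c = 1"
  by (simp flip: const2_mult)

lemma const2_mult_cancel [simp]: "c \<noteq> 0 \<Longrightarrow> const2 (inverse c) * (const2 c * F) = F"
  by (simp add: const2_inverse flip: mult.assoc)

lemma const2_eq_0_iff [simp]: "const2 c = 0 \<longleftrightarrow> c = 0"
  by transfer simp

text \<open>The ring as a module over itself: submodules are the ideals and \<open>idl.span\<close>
  is the generated ideal, so the span calculus applies to ideals. The second interpretation,
  \<open>cv\<close>, is the complex vector space structure in which colengths are counted.\<close>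

interpretation idl: Modules.module "(*) :: conv2 \<Rightarrow> conv2 \<Rightarrow> conv2"
  by unfold_locales (simp_all add: distrib_left distrib_right mult.assoc)

interpretation cv: vector_space "\<lambda>c F. const2 c * F"
  by (unfold_locales; simp only: distrib_left distrib_right const2_add const2_mult const2_simps mult.assoc mult_1_left)

(* The simp rule scale_scale is oriented against mult.assoc, so the two loop together. *)
declare idl.scale_scale [simp del] cv.scale_scale [simp del]

lemma ideal_imp_cv_subspace: "idl.subspace I \<Longrightarrow> cv.subspace I"
  by (auto simp: idl.subspace_def cv.subspace_def)

lemma ideal_span_pair: "idl.span {a, b} = {a * u + b * v | u v. True}"
proof (intro equalityI subsetI)
  fix x assume "x \<in> idl.span {a, b}"
  then obtain k l where "x - k * a = l * b"
    by (auto simp: idl.span_breakdown_eq idl.span_singleton)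
  then have "x = a * k + b * l" by (simp add: algebra_simps)
  then show "x \<in> {a * u + b * v | u v. True}" by blast
next
  fix x assume "x \<in> {a * u + b * v | u v. True}"
  then obtain u v where "x = u * a + v * b" by (auto simp: mult.commute)
  moreover have "u * a + v * b \<in> idl.span {a, b}"
    by (intro idl.span_add idl.span_scale idl.span_base) auto
  ultimately show "x \<in> idl.span {a, b}" by simp
qed

text \<open>Counterpart of \<open>line_extension\<close>, the step from which the dimension in a
  ring is built; \<open>qdim_eqI\<close> matches the two.\<close>

definition cline :: "conv2 \<Rightarrow> conv2 set \<Rightarrow> conv2 set" where
  "cline v E = {const2 c * v + e | c e. e \<in> E}"

lemma clineI: "e \<in> E \<Longrightarrow> x = const2 c * v + e \<Longrightarrow> x \<in> cline v E"
  unfolding cline_def by blast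

lemma clineE:
  assumes "x \<in> cline v E"
  obtains c e where "x = const2 c * v + e" "e \<in> E"
  using assms unfolding cline_def by blast

text \<open>For an ideal \<open>N\<close> this is the preimage in the ring of the image of
  \<open>E\<close> under multiplication by \<open>a\<close> modulo \<open>N\<close>. With
  \<open>a = 1\<close> it is the sum of \<open>E\<close> and \<open>N\<close>.\<close>

definition mulset :: "conv2 \<Rightarrow> conv2 set \<Rightarrow> conv2 set \<Rightarrow> conv2 set" where
  "mulset a N E = {a * e + p | e p. e \<in> E \<and> p \<in> N}"

lemma mulsetI: "e \<in> E \<Longrightarrow> p \<in> N \<Longrightarrow> x = a * e + p \<Longrightarrow> x \<in> mulset a N E"
  unfolding mulset_def by blast

lemma mulsetE:
  assumes "x \<in> mulset a N E"
  obtains e p where "x = a * e + p" "e \<in> E" "p \<in> N"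
  using assms unfolding mulset_def by blast

lemma mulset_cline: "mulset a N (cline v E) = cline (a * v) (mulset a N E)"
proof (intro equalityI subsetI)
  fix x assume "x \<in> mulset a N (cline v E)"
  then obtain c e p where x: "x = a * (const2 c * v + e) + p" "e \<in> E" "p \<in> N"
    by (elim mulsetE clineE) simp
  have "a * e + p \<in> mulset a N E" using x by (intro mulsetI) auto
  moreover have "x = const2 c * (a * v) + (a * e + p)" unfolding x by (simp add: algebra_simps)
  ultimately show "x \<in> cline (a * v) (mulset a N E)" by (rule clineI)
next
  fix x assume "x \<in> cline (a * v) (mulset a N E)"
  then obtain c e p where x: "x = const2 c * (a * v) + (a * e + p)" "e \<in> E" "p \<in> N"
    by (elim mulsetE clineE) simp
  have "const2 c * v + e \<in> cline v E" using x by (intro clineI) auto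
  moreover have "x = a * (const2 c * v + e) + p" unfolding x by (simp add: algebra_simps)
  ultimately show "x \<in> mulset a N (cline v E)" using x(3) by (intro mulsetI)
qed

lemma cv_subspace_cline:
  assumes "cv.subspace E"
  shows "cv.subspace (cline v E)"
proof (rule cv.subspaceI)
  show "0 \<in> cline v E"
    by (rule clineI[OF cv.subspace_0[OF assms], of _ 0]) simp
  fix x assume "x \<in> cline v E"
  then obtain a e where x: "x = const2 a * v + e" "e \<in> E" by (rule clineE)
  have "const2 k * x = const2 (k * a) * v + const2 k * e" for k
    unfolding x by (simp add: const2_mult algebra_simps)
  then show "const2 k * x \<in> cline v E" for k
    using clineI cv.subspace_scale[OF assms x(2)] by blast
  fix y assume "y \<in> cline v E"
  then obtain b d where y: "y = const2 b * v + d" "d \<in> E" by (rule clineE)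
  have "x + y = const2 (a + b) * v + (e + d)"
    unfolding x y by (simp add: const2_add algebra_simps)
  then show "x + y \<in> cline v E"
    using clineI cv.subspace_add[OF assms x(2) y(2)] by blast
qed

lemma subset_cline: "E \<subseteq> cline v E"
  by (auto intro: clineI[where c = 0])

lemma cline_absorb:
  assumes "cv.subspace E" "v \<in> E"
  shows "cline v E = E"
proof
  show "cline v E \<subseteq> E"
    using cv.subspace_add[OF assms(1) cv.subspace_scale[OF assms]] by (force elim: clineE)
qed (rule subset_cline)

text \<open>A derivation witnesses that E / I has dimension \<open>n\<close>, finiteness included.
  That \<open>n\<close> is unique is not built into the relation; for an ideal \<open>I\<close>
  inside the whole ring it follows from \<open>qdim_eqI\<close>.\<close>

inductive reldim :: "conv2 set \<Rightarrow> nat \<Rightarrow> conv2 set \<Rightarrow> bool" for I where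
  reldim_refl: "reldim I 0 I"
| reldim_step: "reldim I n E \<Longrightarrow> v \<notin> E \<Longrightarrow> reldim I (Suc n) (cline v E)"

lemma reldim_subspace:
  assumes "reldim I n E" "cv.subspace I"
  shows "cv.subspace E" "I \<subseteq> E"
  using assms by (induction) (simp_all add: cv_subspace_cline subset_trans[OF _ subset_cline])

lemma reldim_trans:
  assumes "reldim E m F" "reldim I n E"
  shows "reldim I (n + m) F"
  using assms
proof (induction)
  case reldim_refl
  then show ?case by simp
next
  case (reldim_step m F v)
  then show ?case using reldim.reldim_step[of I "n + m" F v] by simp
qed

text \<open>Adding \<open>J\<close> to every member of a chain gives a chain again once those steps
  are dropped whose new vector already lies in the sum. Hence only the existence of some length
  \<open>m\<close> is claimed.\<close>

lemma finite_reldim_sup: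
  assumes "reldim I n E" "cv.subspace I" "cv.subspace J" "I \<subseteq> J"
  shows "\<exists>m. reldim J m (mulset 1 J E)"
  using assms
proof (induction)
  case reldim_refl
  have "mulset 1 J I \<subseteq> J"
    using cv.subspace_add[OF reldim_refl(2)] reldim_refl(3) by (force elim!: mulsetE)
  moreover have "J \<subseteq> mulset 1 J I"
    using cv.subspace_0[OF reldim_refl(1)] by (auto intro: mulsetI[where e = 0])
  ultimately show ?case using reldim.reldim_refl[of J] by auto
next
  case (reldim_step n E v)
  then obtain m where m: "reldim J m (mulset 1 J E)" by blast
  have "cv.subspace (mulset 1 J E)" using reldim_subspace(1)[OF m] reldim_step by blast
  then show ?case
    using m reldim.reldim_step[OF m, of v] cline_absorb[of "mulset 1 J E" v]
    by (cases "v \<in> mulset 1 J E") (use mulset_cline[of 1 J v E] in auto)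
qed

lemma finite_codim_mono:
  assumes "reldim I n UNIV" "cv.subspace I" "cv.subspace J" "I \<subseteq> J"
  shows "\<exists>m. reldim J m UNIV"
proof -
  have "mulset 1 J UNIV = UNIV"
    using cv.subspace_0[OF assms(3)] by (auto intro: mulsetI[where p = 0])
  then show ?thesis using finite_reldim_sup[OF assms] by simp
qed

text \<open>Multiplication by \<open>a\<close> is injective modulo \<open>N\<close>, so it carries a
  chain to a chain of the same length: a relation a v = a e + p with p in \<open>N\<close> puts v -
  e into \<open>N\<close>, hence v into \<open>E\<close>.\<close>

lemma reldim_mulset:
  assumes "reldim I n E" "idl.subspace N" "cv.subspace I" "N \<subseteq> I"
    and reg: "\<And>x. a * x \<in> N \<Longrightarrow> x \<in> N"
  shows "reldim (mulset a N I) n (mulset a N E)"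
  using assms(1)
proof (induction)
  case (reldim_step n E v)
  have E: "cv.subspace E" "I \<subseteq> E" using reldim_subspace[OF reldim_step(1) assms(3)] .
  have "a * v \<notin> mulset a N E"
  proof
    assume "a * v \<in> mulset a N E"
    then obtain e p where e: "a * v = a * e + p" "e \<in> E" "p \<in> N" by (rule mulsetE)
    then have "a * (v - e) = p" by (simp add: right_diff_distrib)
    then have "v - e \<in> E" using reg e(3) assms(4) E by blast
    then have "v - e + e \<in> E" using e E by (intro cv.subspace_add)
    then show False using reldim_step by simp
  qed
  then show ?case using reldim.reldim_step[OF reldim_step(3)] by (simp add: mulset_cline)
qed (rule reldim_refl)

section \<open>Quotients of the power series ring and their dimension\<close>

lemma O2_simps:
  "carrier O2 = UNIV" "x \<otimes>\<^bsub>O2\<^esub> y = x * y" "\<one>\<^bsub>O2\<^esub> = 1" "\<zero>\<^bsub>O2\<^esub> = 0" "x \<oplus>\<^bsub>O2\<^esub> y = x + y"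
  by (auto simp: O2_def ring_of_type_algebra_def)

interpretation O2: cring O2
  unfolding O2_def by (rule cring_from_type_algebra)

lemma ideal_O2_iff: "ideal I O2 \<longleftrightarrow> idl.subspace I"
proof
  assume "ideal I O2"
  then interpret ideal I O2 .
  show "idl.subspace I"
    using additive_subgroup.zero_closed[OF additive_subgroup_axioms]
      additive_subgroup.a_closed[OF additive_subgroup_axioms] I_l_closed
    by (auto simp: idl.subspace_def O2_simps)
next
  assume I: "idl.subspace I"
  show "ideal I O2"
  proof (rule idealI)
    show "subgroup I (add_monoid O2)"
    proof (rule O2.add.subgroupI)
      fix a assume "a \<in> I"
      have "\<ominus>\<^bsub>O2\<^esub> a = - a"
        by (rule O2.minus_equality) (auto simp: O2_simps)
      then show "\<ominus>\<^bsub>O2\<^esub> a \<in> I" using I \<open>a \<in> I\<close> idl.subspace_neg by simp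
    qed (use I idl.subspace_0[OF I] in \<open>auto simp: O2_simps intro: idl.subspace_add\<close>)
  next
    fix a x assume "a \<in> I"
    then have "x * a \<in> I" using I by (rule idl.subspace_scale[rotated])
    then show "x \<otimes>\<^bsub>O2\<^esub> a \<in> I" "a \<otimes>\<^bsub>O2\<^esub> x \<in> I" by (simp_all add: O2_simps mult.commute)
  qed (simp add: O2.ring_axioms)
qed

lemma genideal_O2: "genideal O2 S = idl.span S"
proof
  show "genideal O2 S \<subseteq> idl.span S"
    by (rule O2.genideal_minimal) (auto simp: ideal_O2_iff idl.span_superset)
  have "ideal (genideal O2 S) O2" by (rule O2.genideal_ideal) (simp add: O2_simps)
  then show "idl.span S \<subseteq> genideal O2 S"
    by (intro idl.span_minimal O2.genideal_self) (auto simp: O2_simps ideal_O2_iff)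
qed

lemma subfield_const2: "subfield (range const2) O2"
proof (rule O2.subfieldI)
  have "subring (range const2) O2"
  proof (rule O2.subringI)
    fix h assume "h \<in> range const2"
    then obtain c where c: "h = const2 c" by blast
    have "\<ominus>\<^bsub>O2\<^esub> h = const2 (- c)"
      by (rule O2.minus_equality) (auto simp: O2_simps c const2_minus)
    then show "\<ominus>\<^bsub>O2\<^esub> h \<in> range const2" by simp
  next
    show "\<one>\<^bsub>O2\<^esub> \<in> range const2" by (metis O2_simps(3) const2_simps(2) rangeI)
  qed (auto simp: O2_simps simp flip: const2_add const2_mult)
  then show "subcring (range const2) O2"
    by (rule O2.subcringI) (auto simp: O2_simps mult.commute)
  have "\<exists>y. const2 y * const2 x = 1" if "const2 x \<noteq> 0" for x
    using that const2_inverse[of x] by auto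
  then show "Units (O2\<lparr>carrier := range const2\<rparr>) = range const2 - {\<zero>\<^bsub>O2\<^esub>}"
    by (auto simp: Units_def O2_simps mult.commute simp del: const2_eq_0_iff)
qed

text \<open>The quotient map turns each step of the chain into a line extension over the image of
  the constants; the new vector stays outside because every member of the chain contains the kernel
  \<open>I\<close>.\<close>

lemma qdim_eqI:
  assumes "reldim (idl.span S) n UNIV"
  shows "qdim S = n"
proof -
  define I where "I = idl.span S"
  define Q where "Q = O2 Quot I"
  define p where "p = (\<lambda>x. I +>\<^bsub>O2\<^esub> x)"
  define K where "K = range (\<lambda>c. p (const2 c))"
  have I: "ideal I O2" "idl.subspace I" by (auto simp: ideal_O2_iff I_def)
  interpret I: ideal I O2 by fact
  interpret p: ring_hom_ring O2 Q p unfolding p_def Q_def by (rule I.rcos_ring_hom_ring)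
  have padd: "p (x + y) = p x \<oplus>\<^bsub>Q\<^esub> p y" for x y using p.hom_add[of x y] by (simp add: O2_simps)
  have pmult: "p (x * y) = p x \<otimes>\<^bsub>Q\<^esub> p y" for x y using p.hom_mult[of x y] by (simp add: O2_simps)
  have carr: "carrier Q = range p"
    by (auto simp: Q_def FactRing_def A_RCOSETS_def' p_def O2_simps(1))
  have mem: "p x \<in> carrier Q" for x by (simp add: carr)
  have p0: "p x = \<zero>\<^bsub>Q\<^esub> \<longleftrightarrow> x \<in> I" for x
    unfolding p_def Q_def FactRing_def
    by simp (metis I.a_rcos_const I.a_rcos_self O2_simps(1) UNIV_I)
  have peq: "p x = p y \<longleftrightarrow> x - y \<in> I" for x y
  proof -
    have "p x = p (x - y) \<oplus>\<^bsub>Q\<^esub> p y" by (simp flip: padd)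
    then have "p x = p y \<longleftrightarrow> p (x - y) = \<zero>\<^bsub>Q\<^esub>"
      using mem p.S.add.l_cancel_one' p.S.add.r_cancel_one' by (metis p.S.a_comm)
    then show ?thesis by (simp add: p0)
  qed
  have dim: "p.S.dimension n K (p ` E)" if "reldim I n E" for n E
    using that
  proof induction
    case reldim_refl
    have "p ` I = {\<zero>\<^bsub>Q\<^esub>}" using p0 idl.subspace_0[OF I(2)] by auto
    then show ?case by simp
  next
    case (reldim_step n E v)
    have E: "cv.subspace E" "I \<subseteq> E" using reldim_subspace reldim_step I ideal_imp_cv_subspace by blast+
    have "p v \<notin> p ` E"
    proof
      assume "p v \<in> p ` E"
      then obtain e where "e \<in> E" "v - e \<in> I" by (auto simp: peq)
      then have "v - e + e \<in> E" using E cv.subspace_add by blast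
      then show False using reldim_step by simp
    qed
    then have "p.S.dimension (Suc n) K (p.S.line_extension K (p v) (p ` E))"
      using reldim_step mem by (intro p.S.dimension.Suc_dim) auto
    also have "p.S.line_extension K (p v) (p ` E) = p ` cline v E"
    proof -
      have "p.S.line_extension K (p v) (p ` E) = {p (const2 c) \<otimes>\<^bsub>Q\<^esub> p v \<oplus>\<^bsub>Q\<^esub> p e | c e. e \<in> E}"
        unfolding p.S.line_extension_def set_add_def' r_coset_def K_def by auto
      also have "\<dots> = p ` cline v E"
        by (auto simp: cline_def simp flip: padd pmult)
      finally show ?thesis .
    qed
    finally show ?case .
  qed
  have d: "p.S.dimension n K (carrier Q)"
    using dim[of n UNIV] assms carr by (simp add: I_def)
  have q: "qdim S = p.S.dim K (carrier Q)"
    by (simp add: qdim_def Let_def genideal_O2 I_def Q_def K_def p_def)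
  show ?thesis
  \<comment> \<open>In the zero ring the image of the constants is not a subfield, so uniqueness of
    the dimension is checked by hand there: only dimension 0 occurs.\<close>
  proof (cases "1 \<in> I")
    case True
    then have "I = UNIV" using idl.subspace_scale[OF I(2), of 1] by auto
    then have c: "carrier Q = {\<zero>\<^bsub>Q\<^esub>}" using carr p0 by auto
    have "m = 0 \<and> E = {\<zero>\<^bsub>Q\<^esub>}" if "p.S.dimension m K E" for m E
      using that by induction (auto simp: c)
    then have "p.S.dim K (carrier Q) = n" using d unfolding p.S.dim_def by (intro the_equality) blast+
    then show ?thesis using q by simp
  next
    case False
    have "\<one>\<^bsub>Q\<^esub> = p 1" using p.hom_one by (simp only: O2_simps)
    then have "\<one>\<^bsub>Q\<^esub> \<noteq> \<zero>\<^bsub>Q\<^esub>" using False p0 by metis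
    then have "subfield (p ` range const2) Q" by (rule p.img_is_subfield(2)[OF subfield_const2])
    moreover have "p ` range const2 = K" unfolding K_def by (simp only: image_image)
    ultimately have "subfield K Q" by metis
    then have "(p.S.dim over K) (carrier Q) = n" using d by (rule p.S.dimI)
    then show ?thesis unfolding q over_def .
  qed
qed

section \<open>Units and Weierstrass division\<close>

abbreviation co :: "conv2 \<Rightarrow> nat \<Rightarrow> nat \<Rightarrow> complex" where
  "co F \<equiv> cf (series F)"

lemma co_simps [simp]:
  "co (F + G) i j = co F i j + co G i j"
  "co (F - G) i j = co F i j - co G i j"
  "co (- F) i j = - co F i j"
  "co 0 i j = 0"
  "co 1 i j = (if i = 0 \<and> j = 0 then 1 else 0)"
  "co (const2 c * F) i j = c * co F i j"
  by (simp_all add: cf_def plus_conv2.rep_eq minus_conv2.rep_eq uminus_conv2.rep_eq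
      zero_conv2.rep_eq one_conv2.rep_eq times_conv2.rep_eq const2.rep_eq)

lemma co_sum: "co (sum F A) i j = (\<Sum>a\<in>A. co (F a) i j)"
  by (induction A rule: infinite_finite_induct) auto

lemma co_mult: "co (F * G) i j = (\<Sum>k\<le>i. \<Sum>l\<le>j. co F k l * co G (i - k) (j - l))"
  by (simp add: cf_def times_conv2.rep_eq fps_mult_nth fps_sum_nth atLeast0AtMost)

section \<open>Series with prescribed coefficients, monomials and shifts\<close>

lemma conv2_of_coeffs:
  assumes "R \<ge> 1" "\<And>i j. norm (a i j) \<le> C * R ^ (i + j)"
  shows "\<exists>F. \<forall>i j. co F i j = a i j"
proof -
  define G where "G = Abs_fps (\<lambda>i. Abs_fps (\<lambda>j. a i j))"
  have G: "cf G i j = a i j" for i j by (simp add: G_def cf_def)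
  have "convergent2 G" by (rule convergent2I[OF assms(1)]) (use assms(2) G in simp)
  then have "series (Conv2 G) = G" by (simp add: Conv2_inverse)
  then show ?thesis using G by metis
qed

lemma co_bound:
  obtains C R where "C \<ge> 0" "R \<ge> 1" "\<And>i j. norm (co F i j) \<le> C * R ^ (i + j)"
  using convergent2_bound[of "series F"] series[of F] by auto

lift_definition X2 :: conv2 is "fps_X"
  by (rule convergent2I[where R = 1 and C = 1]) (auto simp: cf_def fps_X_nth)

lift_definition Y2 :: conv2 is "fps_const fps_X"
  by (rule convergent2I[where R = 1 and C = 1]) (auto simp: cf_def fps_X_nth)

lemma co_X2_mult: "co (X2 * F) i j = (if i = 0 then 0 else co F (i - 1) j)"
  by (simp add: cf_def times_conv2.rep_eq X2.rep_eq)

lemma co_Y2_mult: "co (Y2 * F) i j = (if j = 0 then 0 else co F i (j - 1))"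
  by (simp add: cf_def times_conv2.rep_eq Y2.rep_eq)

lemma co_X2_power_mult: "co (X2 ^ n * F) i j = (if i < n then 0 else co F (i - n) j)"
proof (induction n arbitrary: i)
  case (Suc n)
  then show ?case by (cases i) (auto simp: mult.assoc co_X2_mult)
qed auto

lemma co_Y2_power_mult: "co (Y2 ^ n * F) i j = (if j < n then 0 else co F i (j - n))"
proof (induction n arbitrary: j)
  case (Suc n)
  then show ?case by (cases j) (auto simp: mult.assoc co_Y2_mult)
qed auto

lemma co_X2_power: "co (X2 ^ n) i j = (if i = n \<and> j = 0 then 1 else 0)"
  using co_X2_power_mult[of n 1 i j] by auto

lemma co_Y2_power: "co (Y2 ^ n) i j = (if i = 0 \<and> j = n then 1 else 0)"
  using co_Y2_power_mult[of n 1 i j] by auto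

lemma X2_nonzero [simp]: "X2 \<noteq> 0"
  using co_X2_power[of 1 1 0] by auto

lemma Y2_nonzero [simp]: "Y2 \<noteq> 0"
  using co_Y2_power[of 1 0 1] by auto

lemma shift_exists: "\<exists>G. \<forall>i j. co G i j = co F (i + m) (j + n)"
proof -
  obtain C R where F: "C \<ge> 0" "R \<ge> 1" "\<And>i j. norm (co F i j) \<le> C * R ^ (i + j)"
    using co_bound[of F] by blast
  show ?thesis
  proof (rule conv2_of_coeffs[OF F(2), of _ "C * R ^ (m + n)"])
    show "norm (co F (i + m) (j + n)) \<le> C * R ^ (m + n) * R ^ (i + j)" for i j
      using F(3)[of "i + m" "j + n"] by (simp add: power_add algebra_simps)
  qed
qed

lemma restrict_exists: "\<exists>G. \<forall>i j. co G i j = (if P i j then co F i j else 0)"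
proof -
  obtain C R where F: "C \<ge> 0" "R \<ge> 1" "\<And>i j. norm (co F i j) \<le> C * R ^ (i + j)"
    using co_bound[of F] by blast
  show ?thesis
    by (rule conv2_of_coeffs[OF F(2), of _ C]) (use F in auto)
qed

lemma X2_power_dvd:
  assumes "\<And>i j. i < n \<Longrightarrow> co F i j = 0"
  shows "X2 ^ n dvd F"
proof -
  obtain G where "\<And>i j. co G i j = co F (i + n) (j + 0)" using shift_exists by blast
  then have "F = X2 ^ n * G"
    by (intro cf_series_eqI) (use assms in \<open>auto simp: co_X2_power_mult\<close>)
  then show ?thesis by simp
qed

lemma Y2_power_dvd:
  assumes "\<And>i j. j < n \<Longrightarrow> co F i j = 0"
  shows "Y2 ^ n dvd F"
proof -
  obtain G where "\<And>i j. co G i j = co F (i + 0) (j + n)" using shift_exists by blast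
  then have "F = Y2 ^ n * G"
    by (intro cf_series_eqI) (use assms in \<open>auto simp: co_Y2_power_mult\<close>)
  then show ?thesis by simp
qed

section \<open>Majorants, inverses and Weierstrass division\<close>

lemma partial_sums_bound:
  obtains \<rho> t where "\<rho> > 0" "t \<ge> 0"
    "\<And>A. finite A \<Longrightarrow> (\<Sum>(i, j)\<in>A. norm (co F i j) * \<rho> ^ i * \<rho> ^ j) \<le> t"
proof -
  obtain \<rho> :: real where \<rho>: "\<rho> > 0"
    and s: "(\<lambda>(i, j). norm (co F i j) * \<rho> ^ i * \<rho> ^ j) summable_on (UNIV :: (nat \<times> nat) set)"
    using series[of F] by (auto simp: convergent2_def)
  define t where "t = (\<Sum>\<^sub>\<infinity>(i, j). norm (co F i j) * \<rho> ^ i * \<rho> ^ j)"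
  have t: "(\<Sum>(i, j)\<in>A. norm (co F i j) * \<rho> ^ i * \<rho> ^ j) \<le> t" if "finite A" for A
    unfolding t_def using that \<rho> by (intro finite_sum_le_infsum[OF s]) auto
  show thesis using that[OF \<rho> _ t] t[of "{}"] by simp
qed

text \<open>The Banach algebra estimate \<open>|ab| \<le> |a|\<^sub>1 |b|\<^sub>\<infinity>\<close> for weighted coefficient norms.\<close>

lemma convolution_bound:
  fixes a b :: "nat \<Rightarrow> nat \<Rightarrow> complex" and P S :: real
  assumes "P > 0" "S > 0" "K \<ge> 0"
    and a: "(\<Sum>k\<le>i. \<Sum>l\<le>j. norm (a k l) / (P ^ k * S ^ l)) \<le> t"
    and b: "\<And>k l. k \<le> i \<Longrightarrow> l \<le> j \<Longrightarrow> a k l \<noteq> 0 \<Longrightarrow> norm (b (i - k) (j - l)) \<le> K * P ^ (i - k) * S ^ (j - l)"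
  shows "norm (\<Sum>k\<le>i. \<Sum>l\<le>j. a k l * b (i - k) (j - l)) \<le> t * K * P ^ i * S ^ j"
proof -
  have le: "norm (a k l * b (i - k) (j - l)) \<le> K * P ^ i * S ^ j * (norm (a k l) / (P ^ k * S ^ l))"
    if "k \<le> i" "l \<le> j" for k l
  proof (cases "a k l = 0")
    case False
    have "P ^ i = P ^ (i - k) * P ^ k" "S ^ j = S ^ (j - l) * S ^ l"
      using that by (simp_all flip: power_add)
    moreover have "norm (a k l) * norm (b (i - k) (j - l)) \<le> norm (a k l) * (K * P ^ (i - k) * S ^ (j - l))"
      using b[OF that False] by (intro mult_left_mono) auto
    ultimately show ?thesis using assms(1,2) by (simp add: norm_mult field_simps)
  qed auto
  have "norm (\<Sum>k\<le>i. \<Sum>l\<le>j. a k l * b (i - k) (j - l)) \<le>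
      (\<Sum>k\<le>i. \<Sum>l\<le>j. K * P ^ i * S ^ j * (norm (a k l) / (P ^ k * S ^ l)))"
    using le by (intro sum_norm_le order.trans[OF norm_sum] sum_mono) auto
  also have "\<dots> = K * P ^ i * S ^ j * (\<Sum>k\<le>i. \<Sum>l\<le>j. norm (a k l) / (P ^ k * S ^ l))"
    by (simp only: sum_distrib_left)
  also have "\<dots> \<le> K * P ^ i * S ^ j * t"
    using a assms by (intro mult_left_mono) auto
  finally show ?thesis by (simp add: mult_ac)
qed

text \<open>The bound t is uniform in the second weight S \<ge> P. So S may be enlarged afterwards
  to beat a constant that depends on t and P, as Weierstrass division requires.\<close>

lemma weighted_sum_bound:
  "\<exists>P t. P \<ge> 1 \<and> t \<ge> 0 \<and> P \<ge> P0 \<and>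
    (\<forall>i j S. S \<ge> P \<longrightarrow> (\<Sum>k\<le>i. \<Sum>l\<le>j. norm (co F k l) / (P ^ k * S ^ l)) \<le> t)"
proof -
  obtain \<rho> t where \<rho>: "\<rho> > 0" "t \<ge> 0"
    "\<And>A. finite A \<Longrightarrow> (\<Sum>(i, j)\<in>A. norm (co F i j) * \<rho> ^ i * \<rho> ^ j) \<le> t"
    using partial_sums_bound[of F] by blast
  define P where "P = max (max 1 P0) (1 / \<rho>)"
  have P: "P \<ge> 1" "P \<ge> P0" "1 / P \<le> \<rho>"
  proof -
    show "P \<ge> 1" "P \<ge> P0" by (auto simp: P_def)
    have "1 / \<rho> \<le> P" by (simp add: P_def)
    then show "1 / P \<le> \<rho>" using \<rho> \<open>P \<ge> 1\<close> by (simp add: field_simps)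
  qed
  have "(\<Sum>k\<le>i. \<Sum>l\<le>j. norm (co F k l) / (P ^ k * S ^ l)) \<le> t" if "S \<ge> P" for i j S
  proof -
    have S: "1 / S \<le> \<rho>"
      using that P by (smt (verit) frac_le)
    have "norm (co F k l) / (P ^ k * S ^ l) \<le> norm (co F k l) * \<rho> ^ k * \<rho> ^ l" for k l
    proof -
      have "norm (co F k l) / (P ^ k * S ^ l) = norm (co F k l) * (1 / P) ^ k * (1 / S) ^ l"
        by (simp add: power_divide)
      also have "\<dots> \<le> norm (co F k l) * \<rho> ^ k * \<rho> ^ l"
        using P S that \<rho> by (intro mult_mono power_mono mult_nonneg_nonneg) auto
      finally show ?thesis .
    qed
    then have "(\<Sum>k\<le>i. \<Sum>l\<le>j. norm (co F k l) / (P ^ k * S ^ l)) \<le>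
        (\<Sum>k\<le>i. \<Sum>l\<le>j. norm (co F k l) * \<rho> ^ k * \<rho> ^ l)"
      by (intro sum_mono)
    also have "\<dots> = (\<Sum>(k, l)\<in>{..i} \<times> {..j}. norm (co F k l) * \<rho> ^ k * \<rho> ^ l)"
      by (simp add: sum.cartesian_product)
    also have "\<dots> \<le> t" by (rule \<rho>) auto
    finally show ?thesis .
  qed
  then show ?thesis using P \<rho> by blast
qed

text \<open>The formal inverse U obeys U = 1 + T U, and only its convergence is at stake. Each term
  of \<open>T\<close> has total degree at least one, so scaling both weights by
  \<open>max 1 t\<close> brings the weighted norm of \<open>T\<close> down to at most 1; induction
  on the total degree then bounds the coefficients of U by powers of S.\<close>

lemma one_minus_right_inverse:
  assumes "co T 0 0 = 0"
  shows "\<exists>G. (1 - T) * G = 1"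
proof -
  obtain P t where P: "P \<ge> 1" "t \<ge> 0"
    and s: "\<And>i j S. S \<ge> P \<Longrightarrow> (\<Sum>k\<le>i. \<Sum>l\<le>j. norm (co T k l) / (P ^ k * S ^ l)) \<le> t"
    using weighted_sum_bound[of 1 T] by blast
  define S where "S = P * max 1 t"
  have S: "S \<ge> P" "S \<ge> 1"
    using P mult_mono[of 1 P 1 "max 1 t"] mult_left_mono[of 1 "max 1 t" P] by (auto simp: S_def)
  have s1: "(\<Sum>k\<le>i. \<Sum>l\<le>j. norm (co T k l) / (S ^ k * S ^ l)) \<le> 1" for i j
  proof -
    define m where "m = max 1 t"
    have m: "m \<ge> 1" "t \<le> m" by (auto simp: m_def)
    have "norm (co T k l) / (S ^ k * S ^ l) \<le> norm (co T k l) / (P ^ k * P ^ l) / m" for k l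
    proof (cases "k = 0 \<and> l = 0")
      case False
      then have "m ^ 1 \<le> m ^ (k + l)" using m by (intro power_increasing) auto
      then have "(P ^ k * P ^ l) * m \<le> (P ^ k * P ^ l) * m ^ (k + l)"
        using P by (intro mult_left_mono) auto
      also have "\<dots> = S ^ k * S ^ l"
        unfolding S_def m_def[symmetric] by (simp add: power_mult_distrib power_add mult_ac)
      finally have "norm (co T k l) / (S ^ k * S ^ l) \<le> norm (co T k l) / ((P ^ k * P ^ l) * m)"
        using P m S by (intro divide_left_mono mult_pos_pos) auto
      then show ?thesis by simp
    qed (use assms in auto)
    then have "(\<Sum>k\<le>i. \<Sum>l\<le>j. norm (co T k l) / (S ^ k * S ^ l)) \<le>
        (\<Sum>k\<le>i. \<Sum>l\<le>j. norm (co T k l) / (P ^ k * P ^ l) / m)"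
      by (intro sum_mono)
    also have "\<dots> = (\<Sum>k\<le>i. \<Sum>l\<le>j. norm (co T k l) / (P ^ k * P ^ l)) / m"
      by (simp add: sum_divide_distrib)
    also have "\<dots> \<le> t / m" using s[of P j i] m by (intro divide_right_mono) auto
    also have "\<dots> \<le> 1" using m by simp
    finally show ?thesis .
  qed
  define H where "H = 1 - series T"
  have H00: "fps_nth (fps_nth H 0) 0 = 1" using assms by (simp add: H_def cf_def)
  define U where "U = fps_right_inverse H (inverse (fps_nth H 0))"
  have "H * U = 1" unfolding U_def
    by (rule fps_right_inverse) (use H00 in \<open>simp add: inverse_mult_eq_1'\<close>)
  then have U: "U = 1 + series T * U" by (simp add: H_def algebra_simps)
  have rec: "cf U i j = (if i = 0 \<and> j = 0 then 1 else 0) +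
      (\<Sum>k\<le>i. \<Sum>l\<le>j. co T k l * cf U (i - k) (j - l))" for i j
  proof -
    have "cf U i j = cf (1 + series T * U) i j" using U by simp
    also have "\<dots> = (if i = 0 \<and> j = 0 then 1 else 0) +
      (\<Sum>k\<le>i. \<Sum>l\<le>j. co T k l * cf U (i - k) (j - l))"
      by (simp add: cf_def fps_mult_nth fps_sum_nth atLeast0AtMost)
    finally show ?thesis .
  qed
  have "norm (cf U i j) \<le> 1 * S ^ i * S ^ j" for i j
  proof (induction "i + j" arbitrary: i j rule: less_induct)
    case less
    show ?case
    proof (cases "i = 0 \<and> j = 0")
      case True
      then show ?thesis using rec[of i j] assms by simp
    next
      case False
      then have "norm (cf U i j) = norm (\<Sum>k\<le>i. \<Sum>l\<le>j. co T k l * cf U (i - k) (j - l))"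
        by (subst rec) (simp only: if_False add_0_left)
      also have "\<dots> \<le> 1 * 1 * S ^ i * S ^ j"
      proof (rule convolution_bound)
        fix k l assume kl: "k \<le> i" "l \<le> j" "co T k l \<noteq> 0"
        then have "k + l \<noteq> 0" using assms by (metis add_eq_0_iff_both_eq_0)
        then show "norm (cf U (i - k) (j - l)) \<le> 1 * S ^ (i - k) * S ^ (j - l)"
          using kl by (intro less) auto
      qed (use S s1 in auto)
      finally show ?thesis by simp
    qed
  qed
  then have "convergent2 U"
    by (intro convergent2I[of S _ 1]) (use S in \<open>auto simp: power_add\<close>)
  then have "series (Conv2 U) = U" by (simp add: Conv2_inverse)
  then have "(1 - T) * Conv2 U = 1"
    using \<open>H * U = 1\<close>
    by (simp add: H_def series_inject[symmetric] times_conv2.rep_eq minus_conv2.rep_eq one_conv2.rep_eq)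
  then show ?thesis by blast
qed

lemma unit_iff: "F dvd 1 \<longleftrightarrow> co F 0 0 \<noteq> 0"
proof
  assume "F dvd 1"
  then obtain G where "1 = F * G" by (rule dvdE)
  then have "co (F * G) 0 0 = 1" by (metis co_simps(5))
  then show "co F 0 0 \<noteq> 0" by (auto simp: co_mult)
next
  assume c: "co F 0 0 \<noteq> 0"
  obtain G where "(1 - (1 - const2 (inverse (co F 0 0)) * F)) * G = 1"
    using one_minus_right_inverse[of "1 - const2 (inverse (co F 0 0)) * F"] c by auto
  then have "F * (const2 (inverse (co F 0 0)) * G) = 1" by (simp add: algebra_simps)
  then show "F dvd 1" by (metis dvd_triv_left)
qed

text \<open>Solves for the quotient q by recursion on the y-degree: the coefficient of x^(i+n) y^j
  in (x^n + y T) q is q_ij plus a convolution of T with coefficients of q of smaller y-degree, and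
  it has to equal that of the dividend.\<close>

fun weier_quot :: "(nat \<Rightarrow> nat \<Rightarrow> complex) \<Rightarrow> (nat \<Rightarrow> nat \<Rightarrow> complex) \<Rightarrow> nat \<Rightarrow> nat \<Rightarrow> nat \<Rightarrow> complex" where
  "weier_quot t b n i 0 = b (i + n) 0"
| "weier_quot t b n i (Suc j) =
     b (i + n) (Suc j) - (\<Sum>k\<le>i + n. \<Sum>l\<le>j. t k l * weier_quot t b n (i + n - k) (j - l))"

lemma weierstrass_division:
  "\<exists>q. \<forall>i j. i \<ge> n \<longrightarrow> co (F - (X2 ^ n + Y2 * T) * q) i j = 0"
proof -
  define w where "w = weier_quot (co T) (co F) n"
  obtain C R where F: "C \<ge> 0" "R \<ge> 1" "\<And>i j. norm (co F i j) \<le> C * R ^ (i + j)"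
    using co_bound[of F] by blast
  obtain P t where P: "P \<ge> 1" "t \<ge> 0" "P \<ge> R"
    and s: "\<And>i j S. S \<ge> P \<Longrightarrow> (\<Sum>k\<le>i. \<Sum>l\<le>j. norm (co T k l) / (P ^ k * S ^ l)) \<le> t"
    using weighted_sum_bound[of R T] by blast
  \<comment> \<open>The convolution reaches x-degree i + n, which costs P^n, but it ends one
    y-degree lower, which gains 1/S. This S makes its share at most K/2, the same as the share of
    the dividend.\<close>
  define S where "S = max P (2 * t * P ^ n)"
  have S: "S \<ge> P" "S \<ge> 1" "2 * t * P ^ n \<le> S" using P by (auto simp: S_def)
  define K where "K = 2 * C * P ^ n"
  have K: "K \<ge> 0" using F P by (simp add: K_def)
  have Fb: "norm (co F (i + n) j) \<le> K / 2 * P ^ i * S ^ j" for i j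
  proof -
    have "norm (co F (i + n) j) \<le> C * (R ^ (i + n) * R ^ j)" using F(3)[of "i + n" j] by (simp add: power_add)
    also have "\<dots> \<le> C * (P ^ (i + n) * S ^ j)"
      using F P S by (intro mult_left_mono mult_mono power_mono) auto
    finally show ?thesis by (simp add: K_def power_add mult_ac)
  qed
  have bd: "norm (w i j) \<le> K * P ^ i * S ^ j" for i j
  proof (induction j arbitrary: i rule: less_induct)
    case (less j)
    show ?case
    proof (cases j)
      case 0
      have "0 \<le> K * P ^ i" using K P by simp
      then show ?thesis using Fb[of i 0] 0 by (simp add: w_def)
    next
      case (Suc m)
      have "norm (\<Sum>k\<le>i + n. \<Sum>l\<le>m. co T k l * w (i + n - k) (m - l)) \<le> t * K * P ^ (i + n) * S ^ m"
        by (rule convolution_bound) (use P S K s Suc in \<open>auto intro!: less\<close>)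
      also have "\<dots> = (t * P ^ n) * (K * P ^ i * S ^ m)" by (simp add: power_add mult_ac)
      also have "\<dots> \<le> (S / 2) * (K * P ^ i * S ^ m)"
        using S K P by (intro mult_right_mono) auto
      also have "\<dots> = K / 2 * P ^ i * S ^ j" by (simp add: Suc)
      finally have "norm (w i j) \<le> K / 2 * P ^ i * S ^ j + K / 2 * P ^ i * S ^ j"
        using Fb[of i j] unfolding w_def Suc weier_quot.simps
        by (intro order.trans[OF norm_triangle_ineq4] add_mono) auto
      then show ?thesis by simp
    qed
  qed
  have "norm (w i j) \<le> K * S ^ (i + j)" for i j
  proof -
    have "K * P ^ i * S ^ j \<le> K * S ^ i * S ^ j"
      using K P S by (intro mult_right_mono mult_left_mono power_mono) auto
    then show ?thesis using bd[of i j] by (simp add: power_add mult_ac)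
  qed
  then obtain q where q: "\<And>i j. co q i j = w i j"
    using conv2_of_coeffs[OF S(2), of w K] by blast
  have "co ((X2 ^ n + Y2 * T) * q) (i + n) j = co F (i + n) j" for i j
  proof -
    have "co ((X2 ^ n + Y2 * T) * q) (i + n) j = w i j + co (Y2 * (T * q)) (i + n) j"
      by (simp add: distrib_right co_X2_power_mult q mult.assoc)
    also have "\<dots> = co F (i + n) j"
      unfolding co_Y2_mult by (cases j) (simp_all add: w_def co_mult q)
    finally show ?thesis .
  qed
  then have "co (F - (X2 ^ n + Y2 * T) * q) i j = 0" if "i \<ge> n" for i j
    using that le_Suc_ex[of n i] by (auto simp: add.commute)
  then show ?thesis by blast
qed

section \<open>Series in \<open>y\<close> alone and Weierstrass remainders\<close>

definition Yser :: "conv2 set" where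
  "Yser = {F. \<forall>i j. i > 0 \<longrightarrow> co F i j = 0}"

lemma Yser_closed:
  "0 \<in> Yser" "1 \<in> Yser"
  "F \<in> Yser \<Longrightarrow> G \<in> Yser \<Longrightarrow> F + G \<in> Yser"
  "F \<in> Yser \<Longrightarrow> G \<in> Yser \<Longrightarrow> F - G \<in> Yser"
  "F \<in> Yser \<Longrightarrow> G \<in> Yser \<Longrightarrow> F * G \<in> Yser"
proof -
  assume FG: "F \<in> Yser" "G \<in> Yser"
  have "co F k l * co G (i - k) (j - l) = 0" if "i > 0" for i j k l
    using FG that by (cases "k = 0") (auto simp: Yser_def)
  then show "F * G \<in> Yser" by (auto simp: Yser_def co_mult intro!: sum.neutral)
qed (auto simp: Yser_def)

lemma weierstrass_division_polynomial:
  "\<exists>q R. (\<forall>i. R i \<in> Yser) \<and> F = (X2 ^ n + Y2 * T) * q + (\<Sum>i<n. R i * X2 ^ i)"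
proof -
  obtain q where q: "\<And>i j. i \<ge> n \<Longrightarrow> co (F - (X2 ^ n + Y2 * T) * q) i j = 0"
    using weierstrass_division by blast
  define D where "D = F - (X2 ^ n + Y2 * T) * q"
  have "\<exists>G. \<forall>k j. co G k j = (if k = 0 then co D i j else 0)" for i
  proof -
    obtain H where H: "\<And>k j. co H k j = co D (k + i) (j + 0)" using shift_exists by blast
    obtain G where "\<And>k j. co G k j = (if k = 0 then co H k j else 0)"
      using restrict_exists[of "\<lambda>k j. k = 0" H] by blast
    then show ?thesis using H by (intro exI[of _ G]) simp
  qed
  then obtain R where R: "\<And>i k j. co (R i) k j = (if k = 0 then co D i j else 0)"
    by metis
  have "D = (\<Sum>i<n. R i * X2 ^ i)"
  proof (rule cf_series_eqI)
    fix k j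
    have "co (R i * X2 ^ i) k j = (if k = i then co D i j else 0)" for i
      using co_X2_power_mult[of i "R i" k j] by (auto simp: R mult.commute)
    then have "co (\<Sum>i<n. R i * X2 ^ i) k j = (\<Sum>i<n. if k = i then co D i j else 0)"
      by (simp add: co_sum)
    also have "\<dots> = co D k j" using q[of k j] by (simp add: D_def)
    finally show "co D k j = co (\<Sum>i<n. R i * X2 ^ i) k j" by simp
  qed
  then have "F = (X2 ^ n + Y2 * T) * q + (\<Sum>i<n. R i * X2 ^ i)" unfolding D_def by (metis diff_add_cancel add.commute)
  moreover have "\<forall>i. R i \<in> Yser" by (simp add: Yser_def R)
  ultimately show ?thesis by blast
qed

text \<open>With m the order of A(x, 0), the terms of x-degree below m are divisible by y, and the
  others add up to x^m times a unit. Dividing by that unit keeps the form because T may be any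
  series.\<close>

lemma X_regular_factor:
  assumes "co A n 0 \<noteq> 0"
  shows "\<exists>n U T. U dvd 1 \<and> A = U * (X2 ^ n + Y2 * T)"
proof -
  define m where "m = (LEAST n. co A n 0 \<noteq> 0)"
  have m: "co A m 0 \<noteq> 0" "\<And>i. i < m \<Longrightarrow> co A i 0 = 0"
    unfolding m_def using LeastI[of "\<lambda>n. co A n 0 \<noteq> 0", OF assms] not_less_Least by blast+
  obtain V where V: "\<And>i j. co V i j = co A (i + m) (j + 0)" using shift_exists by blast
  obtain T0 where T0: "\<And>i j. co T0 i j = co A (i + 0) (j + 1)" using shift_exists by blast
  obtain T where T: "\<And>i j. co T i j = (if i < m then co T0 i j else 0)"
    using restrict_exists[of "\<lambda>i j. i < m" T0] by blast
  have A: "A = X2 ^ m * V + Y2 * T"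
    by (rule cf_series_eqI) (auto simp: co_X2_power_mult co_Y2_mult V T T0 m)
  have "V dvd 1" using m by (simp add: unit_iff V)
  then obtain V' where V': "V * V' = 1" by (metis dvdE)
  have "A = V * (X2 ^ m + Y2 * (V' * T))"
  proof -
    have "V * (X2 ^ m + Y2 * (V' * T)) = X2 ^ m * V + Y2 * (V * V') * T" by (simp add: algebra_simps)
    then show ?thesis by (simp only: A V' mult_1_right)
  qed
  then show ?thesis using \<open>V dvd 1\<close> by blast
qed

text \<open>Removing the largest power of y makes the series x-regular without a linear change of
  coordinates; the factor y^s is treated on its own in \<open>isolated_zero_Y2\<close>.\<close>

lemma weierstrass_factor:
  assumes "A \<noteq> 0"
  shows "\<exists>s n U T. U dvd 1 \<and> A = Y2 ^ s * (U * (X2 ^ n + Y2 * T))"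
proof -
  have "\<exists>j i. co A i j \<noteq> 0" using assms cf_series_eqI[of A 0] by auto
  define s where "s = (LEAST j. \<exists>i. co A i j \<noteq> 0)"
  have "\<exists>i. co A i s \<noteq> 0" unfolding s_def by (rule LeastI_ex) fact
  then obtain n where n: "co A n s \<noteq> 0" by blast
  have "co A i j = 0" if "j < s" for i j
    using not_less_Least[of j "\<lambda>j. \<exists>i. co A i j \<noteq> 0"] that by (auto simp: s_def)
  then obtain A' where A': "A = Y2 ^ s * A'" using Y2_power_dvd by (metis dvdE)
  then have "co A' n 0 \<noteq> 0" using n by (simp add: co_Y2_power_mult)
  then show ?thesis using X_regular_factor A' by metis
qed

lemma Yser_factor:
  assumes "A \<in> Yser" "A \<noteq> 0"
  shows "\<exists>s U. U dvd 1 \<and> A = Y2 ^ s * U"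
proof -
  have "\<exists>j i. co A i j \<noteq> 0" using assms cf_series_eqI[of A 0] by auto
  then have ex: "\<exists>j. co A 0 j \<noteq> 0" using assms by (auto simp: Yser_def) (metis neq0_conv)
  define s where "s = (LEAST j. co A 0 j \<noteq> 0)"
  have s: "co A 0 s \<noteq> 0" unfolding s_def by (rule LeastI_ex[OF ex])
  have "co A i j = 0" if "j < s" for i j
    using not_less_Least[of j "\<lambda>j. co A 0 j \<noteq> 0"] that assms
    by (cases "i = 0") (auto simp: s_def Yser_def)
  then obtain A' where A': "A = Y2 ^ s * A'" using Y2_power_dvd by (metis dvdE)
  then have "co A' 0 0 \<noteq> 0" using s by (simp add: co_Y2_power_mult)
  then show ?thesis using unit_iff A' by blast
qed

section \<open>Evaluation near the origin\<close>

text \<open>Summability and value in one predicate, because \<open>eval2\<close> silently returns 0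
  where the family is not summable, and its ring laws are guaranteed only where it
  converges.\<close>

definition evals :: "conv2 \<Rightarrow> complex \<times> complex \<Rightarrow> complex \<Rightarrow> bool" where
  "evals F p a \<longleftrightarrow> ((\<lambda>(i, j). co F i j * fst p ^ i * snd p ^ j) has_sum a) UNIV"

lemma evals_eval2: "evals F p a \<Longrightarrow> eval2 F p = a"
  by (auto simp: evals_def eval2_def infsumI)

lemma evals_unique: "evals F p a \<Longrightarrow> evals F p b \<Longrightarrow> a = b"
  using evals_eval2 by blast

lemma evals_near_0:
  obtains \<rho> M where "\<rho> > 0" "M \<ge> 0"
    "\<And>x y. norm x \<le> \<rho> \<Longrightarrow> norm y \<le> \<rho> \<Longrightarrow> evals F (x, y) (eval2 F (x, y)) \<and> norm (eval2 F (x, y)) \<le> M"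
proof -
  obtain \<rho> :: real where \<rho>: "\<rho> > 0"
    and s: "(\<lambda>(i, j). norm (co F i j) * \<rho> ^ i * \<rho> ^ j) summable_on (UNIV :: (nat \<times> nat) set)"
    using series[of F] by (auto simp: convergent2_def)
  define M where "M = (\<Sum>\<^sub>\<infinity>(i, j). norm (co F i j) * \<rho> ^ i * \<rho> ^ j)"
  have "M \<ge> 0" unfolding M_def using \<rho> by (intro infsum_nonneg) auto
  have "evals F (x, y) (eval2 F (x, y)) \<and> norm (eval2 F (x, y)) \<le> M"
    if "norm x \<le> \<rho>" "norm y \<le> \<rho>" for x y
  proof -
    have le: "norm (case p of (i, j) \<Rightarrow> co F i j * x ^ i * y ^ j) \<le>
        (case p of (i, j) \<Rightarrow> norm (co F i j) * \<rho> ^ i * \<rho> ^ j)" for p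
      using that \<rho>
      by (auto simp: norm_mult norm_power split: prod.splits intro!: mult_mono power_mono)
    have "(\<lambda>p. norm (case p of (i, j) \<Rightarrow> co F i j * x ^ i * y ^ j)) summable_on UNIV"
      by (rule Infinite_Sum.abs_summable_on_comparison_test'[OF s]) (use le in auto)
    then have sm: "(\<lambda>(i, j). co F i j * x ^ i * y ^ j) summable_on UNIV"
      by (rule abs_summable_summable)
    then have "evals F (x, y) (eval2 F (x, y))"
      by (simp add: evals_def eval2_def has_sum_infsum)
    moreover have "norm (\<Sum>\<^sub>\<infinity>(i, j). co F i j * x ^ i * y ^ j) \<le> M"
      unfolding M_def by (rule norm_infsum_le[OF has_sum_infsum[OF sm] has_sum_infsum[OF s] le])
    ultimately show ?thesis by (simp add: eval2_def)
  qed
  then show thesis using that \<rho> \<open>M \<ge> 0\<close> by blast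
qed

lemma evals_add: "evals F p a \<Longrightarrow> evals G p b \<Longrightarrow> evals (F + G) p (a + b)"
  unfolding evals_def by (drule (1) has_sum_add) (simp add: case_prod_unfold algebra_simps)

lemma evals_const2_mult: "evals F p a \<Longrightarrow> evals (const2 c * F) p (c * a)"
  unfolding evals_def by (drule has_sum_cmult_right[of _ _ _ c]) (simp add: case_prod_unfold mult.assoc[symmetric])

lemma evals_diff: "evals F p a \<Longrightarrow> evals G p b \<Longrightarrow> evals (F - G) p (a - b)"
  using evals_add[of F p a "const2 (-1) * G" "- b"] evals_const2_mult[of G p b "-1"]
  by (simp add: const2_minus)

lemma evals_monomial:
  assumes "\<And>k l. co F k l = (if k = i \<and> l = j then 1 else 0)"
  shows "evals F p (fst p ^ i * snd p ^ j)"
proof -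
  have "((\<lambda>(k, l). co F k l * fst p ^ k * snd p ^ l) has_sum (fst p ^ i * snd p ^ j)) {(i, j)}"
    by (rule has_sum_finiteI) (auto simp: assms)
  then show ?thesis
    unfolding evals_def by (rule has_sum_cong_neutral[THEN iffD1, rotated -1]) (auto simp: assms split: if_splits)
qed

lemma evals_X2_power: "evals (X2 ^ n) (x, y) (x ^ n)"
  using evals_monomial[of "X2 ^ n" n 0 "(x, y)"] by (auto simp: co_X2_power)

lemma evals_Y2_power: "evals (Y2 ^ n) (x, y) (y ^ n)"
  using evals_monomial[of "Y2 ^ n" 0 n "(x, y)"] by (auto simp: co_Y2_power)

lemma evals_0: "evals 0 p 0"
  by (simp add: evals_def case_prod_unfold)

lemma evals_1: "evals 1 (x, y) 1"
  using evals_X2_power[of 0] by simp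

lemma evals_sum:
  assumes "\<And>i. i \<in> A \<Longrightarrow> evals (F i) p (a i)"
  shows "evals (sum F A) p (sum a A)"
  using assms by (induction A rule: infinite_finite_induct) (auto intro: evals_add evals_0)

text \<open>Summability of complex families is absolute, so the product family over pairs of
  exponents is summable and may be regrouped by the exponents of the product.\<close>

lemma evals_mult:
  assumes F: "evals F p a" and G: "evals G p b"
  shows "evals (F * G) p (a * b)"
proof -
  define f where "f = (\<lambda>(i, j). co F i j * fst p ^ i * snd p ^ j)"
  define g where "g = (\<lambda>(i, j). co G i j * fst p ^ i * snd p ^ j)"
  have f: "(f has_sum a) UNIV" and g: "(g has_sum b) UNIV"
    using F G by (simp_all add: f_def g_def evals_def)
  have fa: "(\<lambda>u. norm (f u)) summable_on UNIV" and ga: "(\<lambda>u. norm (g u)) summable_on UNIV"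
    using f g summable_on_iff_abs_summable_on_complex summable_on_def by blast+
  have abs: "(\<lambda>w. norm (case w of (u, v) \<Rightarrow> f u * g v)) summable_on UNIV \<times> UNIV"
    unfolding Infinite_Sum.abs_summable_on_Sigma_iff
    using fa ga
    by (auto simp: norm_mult infsum_cmult_right' infsum_nonneg intro!: summable_on_cmult_right summable_on_cmult_left)
  then have sm: "(\<lambda>(u, v). f u * g v) summable_on UNIV \<times> UNIV"
    by (rule abs_summable_summable)
  have s1: "((\<lambda>(u, v). f u * g v) has_sum (a * b)) (UNIV \<times> UNIV)"
  proof (rule has_sum_SigmaI[OF _ _ sm])
    show "((\<lambda>v. case (u, v) of (u, v) \<Rightarrow> f u * g v) has_sum f u * b) UNIV" for u
      using has_sum_cmult_right[OF g] by simp
    show "((\<lambda>u. f u * b) has_sum a * b) UNIV"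
      using has_sum_cmult_left[OF f] .
  qed
  define T where "T = Sigma (UNIV :: (nat \<times> nat) set) (\<lambda>(m, n). {..m} \<times> {..n})"
  have s2: "((\<lambda>((m, n), (k, l)). f (k, l) * g (m - k, n - l)) has_sum (a * b)) T"
  proof (rule iffD1[OF _ s1])
    show "((\<lambda>(u, v). f u * g v) has_sum (a * b)) (UNIV \<times> UNIV) \<longleftrightarrow>
        ((\<lambda>((m, n), (k, l)). f (k, l) * g (m - k, n - l)) has_sum (a * b)) T"
      by (rule has_sum_reindex_bij_witness
          [where i = "\<lambda>((m, n), (k, l)). ((k, l), (m - k, n - l))"
            and j = "\<lambda>((k, l), (k', l')). ((k + k', l + l'), (k, l))"])
        (auto simp: T_def)
  qed
  have "((\<lambda>(m, n). co (F * G) m n * fst p ^ m * snd p ^ n) has_sum (a * b)) UNIV"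
  proof (rule has_sum_SigmaD[OF s2[unfolded T_def]])
    fix mn :: "nat \<times> nat"
    obtain m n where mn: "mn = (m, n)" by fastforce
    have eq: "f (k, l) * g (m - k, n - l) = co F k l * co G (m - k) (n - l) * (fst p ^ m * snd p ^ n)"
      if "k \<le> m" "l \<le> n" for k l
    proof -
      have "fst p ^ m = fst p ^ k * fst p ^ (m - k)" "snd p ^ n = snd p ^ l * snd p ^ (n - l)"
        using that by (simp_all flip: power_add)
      then show ?thesis by (simp add: f_def g_def)
    qed
    have "(\<Sum>(k, l)\<in>{..m} \<times> {..n}. f (k, l) * g (m - k, n - l)) =
        (\<Sum>(k, l)\<in>{..m} \<times> {..n}. co F k l * co G (m - k) (n - l) * (fst p ^ m * snd p ^ n))"
      by (intro sum.cong) (auto simp: eq)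
    also have "\<dots> = co (F * G) m n * (fst p ^ m * snd p ^ n)"
      by (simp add: co_mult sum.cartesian_product sum_distrib_right case_prod_unfold)
    finally have "(\<Sum>(k, l)\<in>{..m} \<times> {..n}. f (k, l) * g (m - k, n - l)) =
      co (F * G) m n * fst p ^ m * snd p ^ n" by simp
    then show "((\<lambda>kl. (\<lambda>((m, n), (k, l)). f (k, l) * g (m - k, n - l)) (mn, kl)) has_sum
        (\<lambda>(m, n). co (F * G) m n * fst p ^ m * snd p ^ n) mn) ((\<lambda>(m, n). {..m} \<times> {..n}) mn)"
      by (intro has_sum_finiteI) (auto simp: mn case_prod_unfold)
  qed
  then show ?thesis by (simp add: evals_def)
qed

lemma eval2_Yser:
  assumes "F \<in> Yser"
  shows "eval2 F (x, y) = eval2 F (x', y)"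
  unfolding eval2_def
proof (rule infsum_cong)
  fix u :: "nat \<times> nat"
  show "(case u of (i, j) \<Rightarrow> co F i j * fst (x, y) ^ i * snd (x, y) ^ j) =
    (case u of (i, j) \<Rightarrow> co F i j * fst (x', y) ^ i * snd (x', y) ^ j)"
    using assms by (cases "fst u = 0") (auto simp: Yser_def split: prod.splits)
qed

text \<open>Summing by powers of x turns the slice at fixed y into a one-variable power series that
  converges at \<rho>, and such a series is continuous inside the disc.\<close>

lemma continuous_eval2:
  assumes "\<And>x. norm x \<le> \<rho> \<Longrightarrow> evals F (x, y) (eval2 F (x, y))" "\<rho> > 0"
  shows "continuous_on (ball 0 \<rho>) (\<lambda>x. eval2 F (x, y))"
proof -
  define a where "a = (\<lambda>i. \<Sum>\<^sub>\<infinity>j. co F i j * y ^ j)"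
  have sums: "(\<lambda>i. a i * x ^ i) sums eval2 F (x, y)" if x: "norm x \<le> \<rho>" for x
  proof -
    have s: "((\<lambda>(i, j). co F i j * x ^ i * y ^ j) has_sum eval2 F (x, y)) (UNIV \<times> UNIV)"
      using assms(1)[OF x] by (simp add: evals_def)
    have s\<rho>: "((\<lambda>(i, j). co F i j * of_real \<rho> ^ i * y ^ j) has_sum eval2 F (of_real \<rho>, y)) (UNIV \<times> UNIV)"
      using assms(1)[of "of_real \<rho>"] assms(2) by (simp add: evals_def)
    have "(\<lambda>j. co F i j * y ^ j) summable_on UNIV" for i
    proof -
      have "(\<lambda>j. co F i j * of_real \<rho> ^ i * y ^ j) summable_on UNIV"
        using summable_on_SigmaD1[OF has_sum_imp_summable[OF s\<rho>], of i] by simp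
      then have "(\<lambda>j. co F i j * of_real \<rho> ^ i * y ^ j * inverse (of_real \<rho> ^ i)) summable_on UNIV"
        by (rule summable_on_cmult_left)
      then show ?thesis using assms(2) by (simp add: field_simps)
    qed
    then have inner: "((\<lambda>j. co F i j * y ^ j) has_sum a i) UNIV" for i
      unfolding a_def by (rule has_sum_infsum)
    have "((\<lambda>j. co F i j * x ^ i * y ^ j) has_sum a i * x ^ i) UNIV" for i
      using has_sum_cmult_left[OF inner[of i], of "x ^ i"] by (simp add: mult_ac)
    then have "((\<lambda>i. a i * x ^ i) has_sum eval2 F (x, y)) UNIV"
      using has_sum_SigmaD[OF s, of "\<lambda>i. a i * x ^ i"] by simp
    then show ?thesis by (rule has_sum_imp_sums)
  qed
  have "isCont (\<lambda>x. \<Sum>i. a i * x ^ i) x" if "x \<in> ball 0 \<rho>" for x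
    using sums_summable[OF sums[of "of_real \<rho>"]] that assms(2)
    by (intro isCont_powser[of a "of_real \<rho>"]) auto
  then have "continuous_on (ball 0 \<rho>) (\<lambda>x. \<Sum>i. a i * x ^ i)"
    by (simp add: continuous_at_imp_continuous_on)
  then show ?thesis
    by (rule continuous_on_cong[THEN iffD1, rotated -1]) (use sums in \<open>auto intro!: sums_unique[symmetric]\<close>)
qed

text \<open>If \<open>h\<close> is nonzero at a root z of \<open>W\<close>, then \<open>c\<close>
  vanishes there too and the factor x - z cancels on both sides; continuity restores the identity at
  z itself. Both degrees fall by one, so the nonzero \<open>c\<close> runs out of roots before
  \<open>W\<close> does.\<close>

lemma common_root:
  fixes W c :: "complex poly" and h q :: "complex \<Rightarrow> complex"
  assumes "c \<noteq> 0" "Polynomial.degree c < Polynomial.degree W" "\<And>z. poly W z = 0 \<Longrightarrow> z \<in> S" "open S"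
    and "continuous_on S h" "continuous_on S q"
    and "\<And>z. z \<in> S \<Longrightarrow> poly W z * q z = poly c z * h z"
  shows "\<exists>z. poly W z = 0 \<and> h z = 0"
  using assms(1-3,7)
proof (induction "Polynomial.degree W" arbitrary: W c)
  case (Suc n)
  then have "\<not> constant (poly W)" by (simp add: constant_degree)
  then obtain z where z: "poly W z = 0" using fundamental_theorem_of_algebra by blast
  show ?case
  proof (cases "h z = 0")
    case False
    have zS: "z \<in> S" using Suc z by blast
    then have "poly c z = 0" using Suc(6)[of z] z False by simp
    then obtain c1 where c1: "c = [:- z, 1:] * c1" using poly_eq_0_iff_dvd by (metis dvdE)
    obtain W1 where W1: "W = [:- z, 1:] * W1" using z poly_eq_0_iff_dvd by (metis dvdE)
    have nz: "c1 \<noteq> 0" "W1 \<noteq> 0" using Suc(2,3) c1 W1 by auto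
    then have deg: "Polynomial.degree c = Suc (Polynomial.degree c1)" "Polynomial.degree W = Suc (Polynomial.degree W1)"
      using degree_mult_eq[of "[:- z, 1:]"] unfolding c1 W1 by auto
    have off: "poly W1 x * q x - poly c1 x * h x = 0" if "x \<in> S - {z}" for x
    proof -
      have "(x - z) * (poly W1 x * q x) = (x - z) * (poly c1 x * h x)"
        using Suc(6)[of x] that by (simp add: c1 W1 algebra_simps)
      then show ?thesis using that by simp
    qed
    have "continuous_on S (\<lambda>x. poly W1 x * q x - poly c1 x * h x)"
      by (intro continuous_intros assms(5,6))
    then have "isCont (\<lambda>x. poly W1 x * q x - poly c1 x * h x) z"
      using \<open>open S\<close> zS continuous_on_eq_continuous_at by blast
    moreover have "((\<lambda>x. poly W1 x * q x - poly c1 x * h x) \<longlongrightarrow> 0) (at z)"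
    proof (rule Lim_transform_within_open[OF tendsto_const \<open>open S\<close> zS])
      show "0 = poly W1 x * q x - poly c1 x * h x" if "x \<in> S" "x \<noteq> z" for x
        using off[of x] that by simp
    qed
    ultimately have "poly W1 z * q z - poly c1 z * h z = 0"
      unfolding isCont_def using tendsto_unique[OF at_neq_bot] by blast
    then have "poly W1 x * q x = poly c1 x * h x" if "x \<in> S" for x
      using off[of x] that by (cases "x = z") auto
    then have "\<exists>z. poly W1 z = 0 \<and> h z = 0"
      using Suc deg nz by (intro Suc(1)[of W1 c1]) (auto simp: W1)
    then show ?thesis by (auto simp: W1)
  qed (use z in blast)
qed auto

text \<open>If |z| \<ge> \<delta>, then |z|^i \<delta>^n \<le> |z|^n for each i < n, as \<delta>
  \<le> 1. The equation then gives |z|^n \<delta>^n \<le> \<eta> n |z|^n, against the choice of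
  \<eta>.\<close>

lemma monic_root_bound:
  fixes r :: "nat \<Rightarrow> complex"
  assumes "z ^ n = (\<Sum>i<n. r i * z ^ i)" "0 < \<delta>" "\<delta> \<le> 1"
    and "\<And>i. i < n \<Longrightarrow> norm (r i) \<le> \<eta>" "\<eta> \<ge> 0" "\<eta> * n < \<delta> ^ n"
  shows "norm z < \<delta>"
proof (rule ccontr)
  assume "\<not> norm z < \<delta>"
  then have z: "norm z \<ge> \<delta>" by simp
  have "norm z ^ i * \<delta> ^ n \<le> norm z ^ n" if "i < n" for i
  proof -
    have "\<delta> ^ n \<le> \<delta> ^ (n - i)" using assms by (intro power_decreasing) auto
    also have "\<dots> \<le> norm z ^ (n - i)" using z assms by (intro power_mono) auto
    finally have "norm z ^ i * \<delta> ^ n \<le> norm z ^ i * norm z ^ (n - i)"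
      by (intro mult_left_mono) auto
    then show ?thesis using that by (simp flip: power_add)
  qed
  then have le: "norm (r i) * norm z ^ i * \<delta> ^ n \<le> \<eta> * norm z ^ n" if "i < n" for i
    using assms(4)[OF that] that assms(5) mult_mono[of "norm (r i)" \<eta> "norm z ^ i * \<delta> ^ n" "norm z ^ n"] assms(2)
    by (simp add: mult_ac)
  have "norm z ^ n * \<delta> ^ n = norm (\<Sum>i<n. r i * z ^ i) * \<delta> ^ n"
    by (simp flip: assms(1) add: norm_power)
  also have "\<dots> \<le> (\<Sum>i<n. norm (r i) * norm z ^ i) * \<delta> ^ n"
    using assms(2) by (intro mult_right_mono sum_norm_le) (auto simp: norm_mult norm_power)
  also have "\<dots> = (\<Sum>i<n. norm (r i) * norm z ^ i * \<delta> ^ n)" by (simp add: sum_distrib_right)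
  also have "\<dots> \<le> (\<Sum>i<n. \<eta> * norm z ^ n)" by (intro sum_mono le) auto
  also have "\<dots> = (\<eta> * n) * norm z ^ n" by simp
  also have "\<dots> < \<delta> ^ n * norm z ^ n" using assms z by (intro mult_strict_right_mono zero_less_power) auto
  finally show False by (simp add: mult.commute)
qed

text \<open>Fraction-free Gaussian elimination, which keeps all coefficients inside
  \<open>S\<close>; it is applied to the ring of series in y.\<close>

lemma linear_dependence_subring:
  fixes S :: "'a::idom set" and v :: "nat \<Rightarrow> nat \<Rightarrow> 'a"
  assumes S: "0 \<in> S" "1 \<in> S" "\<And>a b. a \<in> S \<Longrightarrow> b \<in> S \<Longrightarrow> a - b \<in> S" "\<And>a b. a \<in> S \<Longrightarrow> b \<in> S \<Longrightarrow> a * b \<in> S"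
    and "\<And>k i. v k i \<in> S" "finite K" "card K > n"
  shows "\<exists>c. (\<forall>k. c k \<in> S) \<and> (\<exists>k\<in>K. c k \<noteq> 0) \<and> (\<forall>i<n. (\<Sum>k\<in>K. c k * v k i) = 0)"
  using assms(5-7)
proof (induction n arbitrary: v K)
  case 0
  then obtain k where "k \<in> K" by fastforce
  then show ?case using S by (intro exI[of _ "\<lambda>_. 1"]) auto
next
  case (Suc n)
  show ?case
  proof (cases "\<forall>k\<in>K. v k n = 0")
    case True
    obtain c where "\<forall>k. c k \<in> S" "\<exists>k\<in>K. c k \<noteq> 0" "\<forall>i<n. (\<Sum>k\<in>K. c k * v k i) = 0"
      using Suc.IH[of v K] Suc.prems by auto
    then show ?thesis using True by (intro exI[of _ c]) (auto simp: less_Suc_eq)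
  next
    case False
    then obtain m where m: "m \<in> K" "v m n \<noteq> 0" by blast
    define L where "L = K - {m}"
    \<comment> \<open>Cross multiplication with the pivot row m clears column n; the coefficient of
      the pivot row is recovered in \<open>d\<close>.\<close>
    define w where "w k i = v m n * v k i - v k n * v m i" for k i
    have L: "finite L" "card L > n" "K = insert m L" "m \<notin> L"
      using m Suc.prems by (auto simp: L_def)
    have "w k i \<in> S" for k i using Suc.prems(1) S(3,4) by (simp add: w_def)
    then obtain c where c: "\<forall>k. c k \<in> S" "\<exists>k\<in>L. c k \<noteq> 0" "\<forall>i<n. (\<Sum>k\<in>L. c k * w k i) = 0"
      using Suc.IH[of w L] L by blast
    define d where "d k = (if k = m then 0 - (\<Sum>k\<in>L. c k * v k n) else v m n * c k)" for k
    have sumS: "sum f A \<in> S" if "\<And>k. f k \<in> S" for f and A :: "nat set"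
    proof (induction A rule: infinite_finite_induct)
      case (insert x A)
      then have "f x - (0 - sum f A) \<in> S" by (intro S(1,3) that)
      then show ?case using insert by simp
    qed (simp_all add: S(1))
    have "d k \<in> S" for k using c(1) Suc.prems(1) by (simp only: d_def split: if_split) (blast intro: S sumS)
    moreover have "\<exists>k\<in>K. d k \<noteq> 0" using c L m by (auto simp: d_def)
    moreover have "(\<Sum>k\<in>K. d k * v k i) = 0" if "i < Suc n" for i
    proof -
      have "(\<Sum>k\<in>L. d k * v k i) = (\<Sum>k\<in>L. v m n * c k * v k i)"
        using L by (intro sum.cong) (auto simp: d_def)
      then have "(\<Sum>k\<in>K. d k * v k i) = (\<Sum>k\<in>L. v m n * c k * v k i) - (\<Sum>k\<in>L. c k * v k n) * v m i"
        using L by (simp add: d_def)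
      also have "\<dots> = (\<Sum>k\<in>L. c k * w k i)"
        by (simp add: w_def algebra_simps sum_subtractf sum_distrib_left)
      also have "\<dots> = 0"
        using c that by (cases "i = n") (auto simp: w_def mult.commute)
      finally show ?thesis .
    qed
    ultimately show ?thesis by blast
  qed
qed

section \<open>The Nullstellensatz\<close>

lemma mem_span_pair: "x \<in> idl.span {a, b} \<longleftrightarrow> (\<exists>u v. x = a * u + b * v)"
  by (auto simp: ideal_span_pair)

lemma span_pairI: "x = a * u + b * v \<Longrightarrow> x \<in> idl.span {a, b}"
  by (auto simp: mem_span_pair)

lemma span_subsetI: "S \<subseteq> idl.span T \<Longrightarrow> idl.span S \<subseteq> idl.span T"
  by (rule idl.span_minimal) auto

lemma span_mult_left: "x \<in> idl.span S \<Longrightarrow> x * c \<in> idl.span S"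
  using idl.span_scale[of x S c] by (simp add: mult.commute)

text \<open>The algebraic form of an isolated common zero: the ideal is primary to the maximal ideal
  or, with \<open>N = 0\<close>, the whole ring. Admitting the whole ring lets unit factors take
  part in products.\<close>

definition primary2 :: "conv2 \<Rightarrow> conv2 \<Rightarrow> bool" where
  "primary2 a b \<longleftrightarrow> (\<exists>N. X2 ^ N \<in> idl.span {a, b} \<and> Y2 ^ N \<in> idl.span {a, b})"

lemma primary2I:
  assumes "X2 ^ M \<in> idl.span {a, b}" "Y2 ^ N \<in> idl.span {a, b}"
  shows "primary2 a b"
  unfolding primary2_def
  using span_mult_left[OF assms(1), of "X2 ^ N"] span_mult_left[OF assms(2), of "Y2 ^ M"]
  by (intro exI[of _ "M + N"]) (simp add: mult.commute flip: power_add)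

lemma primary2_commute: "primary2 a b \<longleftrightarrow> primary2 b a"
  by (simp add: primary2_def insert_commute)

lemma primary2_mono: "primary2 a b \<Longrightarrow> {a, b} \<subseteq> idl.span {c, d} \<Longrightarrow> primary2 c d"
  unfolding primary2_def using span_subsetI by blast

lemma span_pair_mult:
  assumes "x \<in> idl.span {a, c}" "y \<in> idl.span {b, c}"
  shows "x * y \<in> idl.span {a * b, c}"
proof -
  obtain u v u' v' where "x = a * u + c * v" "y = b * u' + c * v'"
    using assms by (auto simp: mem_span_pair)
  then have "x * y = (a * b) * (u * u') + c * (v * y + a * u * v')"
    by (simp add: algebra_simps)
  then show ?thesis by (rule span_pairI)
qed

lemma primary2_mult:
  assumes "primary2 a c" "primary2 b c"
  shows "primary2 (a * b) c"
proof -
  obtain M N where "X2 ^ M \<in> idl.span {a, c}" "Y2 ^ M \<in> idl.span {a, c}"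
    "X2 ^ N \<in> idl.span {b, c}" "Y2 ^ N \<in> idl.span {b, c}"
    using assms by (auto simp: primary2_def)
  then show ?thesis
    by (intro primary2I[of "M + N" _ _ "M + N"]) (auto simp: power_add intro: span_pair_mult)
qed

lemma primary2_unit: "a dvd 1 \<Longrightarrow> primary2 a c"
proof (rule primary2I[where M = 0 and N = 0])
  assume "a dvd 1"
  then obtain b where "1 = a * b" by (rule dvdE)
  then have "1 \<in> idl.span {a, c}" by (intro span_pairI[of _ a b c 0]) simp
  then show "X2 ^ 0 \<in> idl.span {a, c}" "Y2 ^ 0 \<in> idl.span {a, c}" by simp_all
qed

lemma primary2_power: "primary2 a c \<Longrightarrow> primary2 (a ^ n) c"
  by (induction n) (auto intro: primary2_mult primary2_unit)

lemma add_power_decomp: "\<exists>u. (a + b :: 'a::comm_ring_1) ^ n = a * u + b ^ n"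
proof (induction n)
  case (Suc n)
  then obtain u where "(a + b) ^ n = a * u + b ^ n" by blast
  then have "(a + b) ^ Suc n = a * ((a + b) * u + b ^ n) + b ^ Suc n" by (simp add: algebra_simps)
  then show ?case by blast
qed (auto intro: exI[of _ 0])

text \<open>Vanishing at the origin is left out, so that the property passes to factors, units
  included. Polydiscs replace balls because the two variables are later bounded at different
  scales.\<close>

definition isolated_zero :: "conv2 \<Rightarrow> conv2 \<Rightarrow> bool" where
  "isolated_zero A B \<longleftrightarrow> (\<exists>\<epsilon>>0. \<forall>x y. norm x < \<epsilon> \<longrightarrow> norm y < \<epsilon> \<longrightarrow> (x, y) \<noteq> (0, 0) \<longrightarrow>
     \<not> (eval2 A (x, y) = 0 \<and> eval2 B (x, y) = 0))"

definition evaluable :: "real \<Rightarrow> conv2 \<Rightarrow> bool" where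
  "evaluable \<rho> F \<longleftrightarrow> (\<forall>x y. norm x \<le> \<rho> \<longrightarrow> norm y \<le> \<rho> \<longrightarrow> evals F (x, y) (eval2 F (x, y)))"

lemma eventually_at_right_0I:
  fixes P :: "real \<Rightarrow> bool"
  assumes "\<rho> > 0" "\<And>r. r > 0 \<Longrightarrow> r \<le> \<rho> \<Longrightarrow> P r"
  shows "eventually P (at_right 0)"
  using assms by (auto simp: eventually_at_right_field intro!: exI[of _ \<rho>])

text \<open>Phrased with a filter, so that finitely many series get a common radius by
  intersection.\<close>

lemma eventually_evaluable: "eventually (\<lambda>\<rho>. evaluable \<rho> F) (at_right 0)"
proof -
  obtain \<rho> M where "\<rho> > 0"
    "\<And>x y. norm x \<le> \<rho> \<Longrightarrow> norm y \<le> \<rho> \<Longrightarrow> evals F (x, y) (eval2 F (x, y)) \<and> norm (eval2 F (x, y)) \<le> M"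
    by (rule evals_near_0[of F]) metis
  then show ?thesis by (intro eventually_at_right_0I[of \<rho>]) (auto simp: evaluable_def)
qed

lemma eval2_mult:
  assumes "evaluable \<rho> F" "evaluable \<rho> G" "norm x \<le> \<rho>" "norm y \<le> \<rho>"
  shows "eval2 (F * G) (x, y) = eval2 F (x, y) * eval2 G (x, y)"
  using assms by (intro evals_eval2 evals_mult) (auto simp: evaluable_def)

lemma eventually_eval2_small:
  assumes "F \<in> Yser" "co F 0 0 = 0" "\<eta> > 0"
  shows "eventually (\<lambda>\<rho>. \<forall>x y. norm x \<le> \<rho> \<longrightarrow> norm y \<le> \<rho> \<longrightarrow> norm (eval2 F (x, y)) \<le> \<eta>) (at_right 0)"
proof -
  have "Y2 ^ 1 dvd F"
  proof (rule Y2_power_dvd)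
    show "co F i j = 0" if "j < 1" for i j using assms that by (cases "i = 0") (auto simp: Yser_def)
  qed
  then obtain G where F: "F = Y2 ^ 1 * G" by (rule dvdE)
  obtain \<rho> M where \<rho>: "\<rho> > 0" "M \<ge> 0"
    "\<And>x y. norm x \<le> \<rho> \<Longrightarrow> norm y \<le> \<rho> \<Longrightarrow> evals G (x, y) (eval2 G (x, y)) \<and> norm (eval2 G (x, y)) \<le> M"
    by (rule evals_near_0[of G]) metis
  define r where "r = min \<rho> (\<eta> / (M + 1))"
  have "norm (eval2 F (x, y)) \<le> \<eta>" if "norm x \<le> r" "norm y \<le> r" for x y
  proof -
    have "evals F (x, y) (y ^ 1 * eval2 G (x, y))"
      unfolding F using that \<rho>(3)[of x y] by (intro evals_mult evals_Y2_power) (auto simp: r_def)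
    then have "norm (eval2 F (x, y)) = norm y * norm (eval2 G (x, y))"
      by (simp add: evals_eval2 norm_mult)
    also have "\<dots> \<le> \<eta> / (M + 1) * M"
      using that \<rho>(3)[of x y] \<rho>(2) assms by (intro mult_mono) (auto simp: r_def)
    also have "\<dots> \<le> \<eta>" using \<rho> assms by (simp add: field_simps)
    finally show ?thesis .
  qed
  moreover have "r > 0" using \<rho> assms by (simp add: r_def)
  ultimately show ?thesis
    by (intro eventually_at_right_0I[of r]) (auto intro: order.trans)
qed

lemma isolated_zero_factor:
  assumes "isolated_zero A B" "A = W * C"
  shows "isolated_zero W B"
proof -
  obtain \<epsilon> where \<epsilon>: "\<epsilon> > 0" "\<And>x y. norm x < \<epsilon> \<Longrightarrow> norm y < \<epsilon> \<Longrightarrow> (x, y) \<noteq> (0, 0) \<Longrightarrow>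
      \<not> (eval2 A (x, y) = 0 \<and> eval2 B (x, y) = 0)"
    using assms by (auto simp: isolated_zero_def)
  have "eventually (\<lambda>\<rho>. evaluable \<rho> W \<and> evaluable \<rho> C \<and> \<rho> > 0) (at_right 0)"
    by (intro eventually_conj eventually_evaluable eventually_at_right_less)
  from eventually_happens'[OF trivial_limit_at_right_real this]
  obtain \<rho> where \<rho>: "evaluable \<rho> W" "evaluable \<rho> C" "\<rho> > 0"
    by auto
  show ?thesis
    unfolding isolated_zero_def
  proof (intro exI[of _ "min \<epsilon> \<rho>"] conjI allI impI)
    fix x y :: complex assume "norm x < min \<epsilon> \<rho>" "norm y < min \<epsilon> \<rho>" "(x, y) \<noteq> (0, 0)"
    then show "\<not> (eval2 W (x, y) = 0 \<and> eval2 B (x, y) = 0)"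
      using \<epsilon>(2)[of x y] eval2_mult[OF \<rho>(1,2), of x y] assms(2) by auto
  qed (use \<epsilon> \<rho> in auto)
qed

lemma isolated_zero_commute: "isolated_zero A B \<longleftrightarrow> isolated_zero B A"
  by (auto simp: isolated_zero_def)

lemma co_Yser_monomial:
  assumes "R \<in> Yser"
  shows "co (R * X2 ^ i) k j = (if k = i then co R 0 j else 0)"
  using assms co_X2_power_mult[of i R k j] by (auto simp: Yser_def mult.commute)

lemma co_weierstrass_0: "co ((X2 ^ n + Y2 * T) * q) k 0 = (if k < n then 0 else co q (k - n) 0)"
  using co_Y2_mult[of "T * q" k 0] co_X2_power_mult[of n q k 0] by (simp add: distrib_right mult.assoc)

text \<open>Weierstrass preparation, obtained by dividing x^n by x^n + y T. At y = 0 the division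
  reads x^n = x^n q + remainder, which forces q(x, 0) = 1 and makes the remainder coefficients
  vanish at the origin.\<close>

lemma weierstrass_polynomial:
  "\<exists>q r. q dvd 1 \<and> (\<forall>i. r i \<in> Yser) \<and> (\<forall>i<n. co (r i) 0 0 = 0) \<and>
     (X2 ^ n + Y2 * T) * q = X2 ^ n - (\<Sum>i<n. r i * X2 ^ i)"
proof -
  obtain q r where r: "\<And>i. r i \<in> Yser"
    and eq: "X2 ^ n = (X2 ^ n + Y2 * T) * q + (\<Sum>i<n. r i * X2 ^ i)"
    using weierstrass_division_polynomial by blast
  have c: "co (X2 ^ n) k 0 = (if k < n then 0 else co q (k - n) 0) + (if k < n then co (r k) 0 0 else 0)" for k
  proof -
    have "co (\<Sum>i<n. r i * X2 ^ i) k 0 = (\<Sum>i<n. if k = i then co (r i) 0 0 else 0)"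
      using r by (simp add: co_sum co_Yser_monomial)
    also have "\<dots> = (if k < n then co (r k) 0 0 else 0)" by simp
    finally show ?thesis by (subst eq) (simp add: co_weierstrass_0)
  qed
  have "q dvd 1" using c[of n] by (simp add: unit_iff co_X2_power)
  moreover have "co (r i) 0 0 = 0" if "i < n" for i using c[of i] that by (simp add: co_X2_power)
  moreover have "(X2 ^ n + Y2 * T) * q = X2 ^ n - (\<Sum>i<n. r i * X2 ^ i)"
    using eq by (simp add: eq_diff_eq)
  ultimately show ?thesis using r by blast
qed

text \<open>For a fixed small \<open>y \<noteq> 0\<close> the Weierstrass polynomial has \<open>n\<close> small roots, counted with
  multiplicity, and \<open>\<Sum>c\<^sub>k x\<^sup>k\<close> has fewer, so one of them is a root of \<open>B\<close>.\<close>

lemma weierstrass_common_zero: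
  assumes iso: "isolated_zero (X2 ^ n + Y2 * T) B"
    and c: "\<And>k. c k \<in> Yser" "k0 < n" "c k0 \<noteq> 0"
    and eq: "(\<Sum>k<n. c k * X2 ^ k) * B = (X2 ^ n + Y2 * T) * Q"
  shows False
proof -
  define W where "W = X2 ^ n + Y2 * T"
  obtain q r where q: "q dvd 1" and r: "\<And>i. r i \<in> Yser" "\<And>i. i < n \<Longrightarrow> co (r i) 0 0 = 0"
    and Wq: "W * q = X2 ^ n - (\<Sum>i<n. r i * X2 ^ i)"
    using weierstrass_polynomial[of n T] unfolding W_def by blast
  obtain q' where q': "1 = q * q'" using q by (rule dvdE)
  obtain m U where U: "U dvd 1" "c k0 = Y2 ^ m * U" using Yser_factor c by blast
  obtain U' where U': "1 = U * U'" using U(1) by (rule dvdE)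
  obtain \<epsilon> where \<epsilon>: "\<epsilon> > 0" "\<And>x y. norm x < \<epsilon> \<Longrightarrow> norm y < \<epsilon> \<Longrightarrow> (x, y) \<noteq> (0, 0) \<Longrightarrow>
      \<not> (eval2 W (x, y) = 0 \<and> eval2 B (x, y) = 0)"
    using iso by (auto simp: isolated_zero_def W_def)
  define \<FF> where "\<FF> = {W, Q, B, q, q', U, U'} \<union> c ` {..<n} \<union> r ` {..<n}"
  have "eventually (\<lambda>\<rho>. \<rho> < min 1 \<epsilon> \<and> 0 < \<rho> \<and> (\<forall>F\<in>\<FF>. evaluable \<rho> F)) (at_right 0)"
    using \<epsilon>(1) by (intro eventually_conj eventually_ball_finite eventually_evaluable
        eventually_at_right_less ballI order_tendstoD(2)[OF tendsto_ident_at]) (auto simp: \<FF>_def)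
  from eventually_happens'[OF trivial_limit_at_right_real this]
  obtain \<rho> where \<rho>: "\<rho> < min 1 \<epsilon>" "\<rho> > 0" "\<And>F. F \<in> \<FF> \<Longrightarrow> evaluable \<rho> F"
    by auto
  \<comment> \<open>Small enough for \<open>monic_root_bound\<close>: once y is so small that the
    lower coefficients stay below \<eta>, all roots lie in the disc of radius \<rho>, where the
    series of \<open>\<FF>\<close> converge.\<close>
  define \<eta> where "\<eta> = \<rho> ^ n / (2 * (n + 1))"
  have \<eta>: "\<eta> > 0" "\<eta> * n < \<rho> ^ n"
    using \<rho>(2) c(2) by (auto simp: \<eta>_def field_simps intro!: add_pos_nonneg mult_pos_pos)
  have "eventually (\<lambda>\<sigma>. \<sigma> < \<rho> \<and> 0 < \<sigma> \<and> (\<forall>i\<in>{..<n}. \<forall>x y. norm x \<le> \<sigma> \<longrightarrow> norm y \<le> \<sigma> \<longrightarrow>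
      norm (eval2 (r i) (x, y)) \<le> \<eta>)) (at_right 0)"
    using \<rho>(2) \<eta>(1) r by (intro eventually_conj eventually_ball_finite eventually_at_right_less ballI
        eventually_eval2_small order_tendstoD(2)[OF tendsto_ident_at]) auto
  from eventually_happens'[OF trivial_limit_at_right_real this]
  obtain \<sigma> where \<sigma>: "\<sigma> < \<rho>" "\<sigma> > 0"
    "\<And>i x y. i < n \<Longrightarrow> norm x \<le> \<sigma> \<Longrightarrow> norm y \<le> \<sigma> \<Longrightarrow> norm (eval2 (r i) (x, y)) \<le> \<eta>"
    by auto
  define y :: complex where "y = of_real \<sigma>"
  have y: "y \<noteq> 0" "norm y \<le> \<rho>" "norm y \<le> \<sigma>" "norm y < \<epsilon>" using \<sigma> \<rho> by (auto simp: y_def)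
  have ev: "evals F (x, y) (eval2 F (x, y))" if "F \<in> \<FF>" "norm x \<le> \<rho>" for F x
    using \<rho>(3)[OF that(1)] that(2) y(2) by (simp add: evaluable_def)
  define V where "V = Polynomial.monom 1 n - (\<Sum>i<n. Polynomial.monom (eval2 (r i) (0, y)) i)"
  define C where "C = (\<Sum>k<n. Polynomial.monom (eval2 (c k) (0, y)) k)"
  have V: "poly V x = eval2 (W * q) (x, y)" if "norm x \<le> \<rho>" for x
  proof -
    have "evals (W * q) (x, y) (x ^ n - (\<Sum>i<n. eval2 (r i) (x, y) * x ^ i))"
      unfolding Wq by (intro evals_diff evals_sum evals_mult evals_X2_power ev that) (auto simp: \<FF>_def)
    moreover have "eval2 (r i) (x, y) = eval2 (r i) (0, y)" for i by (rule eval2_Yser[OF r(1)])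
    ultimately show ?thesis by (simp add: evals_eval2 V_def poly_monom poly_sum)
  qed
  have C: "evals (\<Sum>k<n. c k * X2 ^ k) (x, y) (poly C x)" if "norm x \<le> \<rho>" for x
  proof -
    have "evals (\<Sum>k<n. c k * X2 ^ k) (x, y) (\<Sum>k<n. eval2 (c k) (x, y) * x ^ k)"
      by (intro evals_sum evals_mult evals_X2_power ev that) (auto simp: \<FF>_def)
    moreover have "eval2 (c k) (x, y) = eval2 (c k) (0, y)" for k by (rule eval2_Yser[OF c(1)])
    ultimately show ?thesis by (simp add: C_def poly_monom poly_sum)
  qed
  have inv: "eval2 q (x, y) \<noteq> 0" if "norm x \<le> \<rho>" for x
  proof -
    have "evals (q * q') (x, y) (eval2 q (x, y) * eval2 q' (x, y))"
      by (intro evals_mult ev that) (auto simp: \<FF>_def)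
    then show ?thesis using evals_unique[OF evals_1] q' by fastforce
  qed
  \<comment> \<open>Since \<open>c k0\<close> is y^m times a unit, its value at the small nonzero y
    is nonzero, so specialising y does not kill the polynomial \<open>C\<close>.\<close>
  have "eval2 U (0, y) \<noteq> 0"
  proof -
    have "evals (U * U') (0, y) (eval2 U (0, y) * eval2 U' (0, y))"
      using \<rho>(2) by (intro evals_mult ev) (auto simp: \<FF>_def)
    then show ?thesis using evals_unique[OF evals_1] U' by fastforce
  qed
  moreover have "evals (c k0) (0, y) (y ^ m * eval2 U (0, y))"
    unfolding U(2) using \<rho>(2) by (intro evals_mult evals_Y2_power ev) (auto simp: \<FF>_def)
  ultimately have "Polynomial.coeff C k0 \<noteq> 0"
    using y(1) c(2) by (simp add: C_def coeff_sum evals_eval2)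
  then have "C \<noteq> 0" by auto
  have "Polynomial.degree C \<le> n - 1"
    by (rule degree_le) (auto simp: C_def coeff_sum)
  moreover have "Polynomial.coeff V n = 1" by (simp add: V_def coeff_sum)
  then have "n \<le> Polynomial.degree V" by (intro le_degree) simp
  ultimately have deg: "Polynomial.degree C < Polynomial.degree V" using c(2) by simp
  have roots: "z \<in> ball 0 \<rho>" if "poly V z = 0" for z
  proof -
    have "norm z < \<rho>"
      using that \<rho> \<eta> \<sigma>(2) \<sigma>(3)[of _ 0 y] y(3)
      by (intro monic_root_bound[of z n "\<lambda>i. eval2 (r i) (0, y)" \<rho> \<eta>])
        (auto simp: V_def poly_monom poly_sum)
    then show ?thesis by simp
  qed
  \<comment> \<open>\<open>V\<close> has the values of W q, so the relation C B = W Q is multiplied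
    by q and the root sought is one of B q; the unit q is discarded afterwards.\<close>
  have "\<exists>z. poly V z = 0 \<and> eval2 B (z, y) * eval2 q (z, y) = 0"
  proof (rule common_root[OF \<open>C \<noteq> 0\<close> deg roots open_ball])
    show "continuous_on (ball 0 \<rho>) (\<lambda>z. eval2 B (z, y) * eval2 q (z, y))"
      by (intro continuous_on_mult continuous_eval2 ev \<rho>(2)) (auto simp: \<FF>_def)
    show "continuous_on (ball 0 \<rho>) (\<lambda>z. eval2 Q (z, y))"
      by (intro continuous_eval2 ev \<rho>(2)) (auto simp: \<FF>_def)
    fix z :: complex assume "z \<in> ball 0 \<rho>"
    then have z: "norm z \<le> \<rho>" by simp
    have "poly V z * eval2 Q (z, y) = eval2 W (z, y) * eval2 q (z, y) * eval2 Q (z, y)"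
      unfolding V[OF z] by (subst eval2_mult[OF \<rho>(3) \<rho>(3) z y(2)]) (auto simp: \<FF>_def)
    also have "\<dots> = eval2 (W * Q) (z, y) * eval2 q (z, y)"
      by (subst eval2_mult[OF \<rho>(3) \<rho>(3) z y(2)]) (auto simp: \<FF>_def)
    also have "eval2 (W * Q) (z, y) = poly C z * eval2 B (z, y)"
      unfolding W_def eq[symmetric] by (intro evals_eval2 evals_mult C ev z) (auto simp: \<FF>_def)
    finally show "poly V z * eval2 Q (z, y) = poly C z * (eval2 B (z, y) * eval2 q (z, y))"
      by (simp add: mult.assoc)
  qed
  then obtain z where z: "poly V z = 0" "eval2 B (z, y) * eval2 q (z, y) = 0" by blast
  have nz: "norm z < \<rho>" using roots[OF z(1)] by simp
  then have "eval2 B (z, y) = 0" using z(2) inv by simp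
  moreover have "eval2 W (z, y) = 0"
  proof -
    have "eval2 W (z, y) * eval2 q (z, y) = 0"
      using V[of z] z(1) nz eval2_mult[OF \<rho>(3) \<rho>(3), of W q z y] y(2) by (simp add: \<FF>_def)
    then show ?thesis using inv nz by simp
  qed
  ultimately show False using \<epsilon>(2)[of z y] nz \<rho>(1) y by simp
qed

text \<open>Modulo \<open>x\<^sup>n + y T\<close> every series is a polynomial in \<open>x\<close> of degree less than \<open>n\<close>, so the \<open>n + 1\<close>
  elements \<open>1, B, x B, \<dots>, x\<^sup>n\<^sup>-\<^sup>1 B\<close> are linearly dependent over the series in \<open>y\<close>.\<close>

lemma weierstrass_nullstellensatz:
  assumes iso: "isolated_zero (X2 ^ n + Y2 * T) B"
  shows "\<exists>M. Y2 ^ M \<in> idl.span {X2 ^ n + Y2 * T, B}"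
proof -
  define W where "W = X2 ^ n + Y2 * T"
  define F where "F k = (if k = n then 1 else B * X2 ^ k)" for k
  have "\<exists>q R. (\<forall>i. R i \<in> Yser) \<and> F k = W * q + (\<Sum>i<n. R i * X2 ^ i)" for k
    unfolding W_def by (rule weierstrass_division_polynomial)
  then obtain q R where R: "\<And>k i. R k i \<in> Yser" "\<And>k. F k = W * q k + (\<Sum>i<n. R k i * X2 ^ i)"
    by metis
  obtain c where c: "\<And>k. c k \<in> Yser" "\<exists>k\<le>n. c k \<noteq> 0" "\<And>i. i < n \<Longrightarrow> (\<Sum>k\<le>n. c k * R k i) = 0"
    using linear_dependence_subring[of Yser R "{..n}" n] Yser_closed R(1) by auto
  define Q where "Q = (\<Sum>k\<le>n. c k * q k)"
  have "(\<Sum>k\<le>n. c k * F k) = W * Q + (\<Sum>k\<le>n. \<Sum>i<n. c k * R k i * X2 ^ i)"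
    by (simp add: R(2) Q_def distrib_left sum.distrib sum_distrib_left mult_ac)
  also have "(\<Sum>k\<le>n. \<Sum>i<n. c k * R k i * X2 ^ i) = (\<Sum>i<n. (\<Sum>k\<le>n. c k * R k i) * X2 ^ i)"
    unfolding sum_distrib_right by (rule sum.swap)
  also have "\<dots> = 0" using c(3) by simp
  finally have "(\<Sum>k\<le>n. c k * F k) = W * Q" by simp
  moreover have "(\<Sum>k\<le>n. c k * F k) = c n + (\<Sum>k<n. c k * X2 ^ k) * B"
    by (simp add: F_def sum_distrib_left mult_ac flip: lessThan_Suc_atMost)
  ultimately have eq: "c n + (\<Sum>k<n. c k * X2 ^ k) * B = W * Q" by simp
  show ?thesis
  \<comment> \<open>Index n carries the element 1. If its coefficient vanishes, a nonzero polynomial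
    of x-degree below n multiplies \<open>B\<close> into the multiples of \<open>W\<close>, which
    \<open>weierstrass_common_zero\<close> excludes. Otherwise \<open>c n\<close>, a unit times a
    power of y, lies in the ideal.\<close>
  proof (cases "c n = 0")
    case True
    then obtain k0 where "k0 < n" "c k0 \<noteq> 0" using c(2) le_less by blast
    then show ?thesis
      using weierstrass_common_zero[OF iso, of c k0 Q] c(1) eq True by (simp add: W_def)
  next
    case False
    then obtain m U where U: "U dvd 1" "c n = Y2 ^ m * U" using Yser_factor c by blast
    obtain U' where U': "1 = U * U'" using U(1) by (rule dvdE)
    have "c n = W * Q + B * (- (\<Sum>k<n. c k * X2 ^ k))" using eq by (simp add: algebra_simps)
    then have "c n * U' \<in> idl.span {W, B}" by (intro span_mult_left span_pairI)
    moreover have "c n * U' = Y2 ^ m" using U' by (simp add: U(2) mult.assoc)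
    ultimately show ?thesis by (auto simp: W_def)
  qed
qed

text \<open>If \<open>B\<close> vanished on y = 0, points of the x-axis arbitrarily near the origin
  would be common zeros. So \<open>B\<close> is x-regular, and modulo y it is a unit times
  x^n.\<close>

lemma isolated_zero_Y2:
  assumes "isolated_zero Y2 B"
  shows "primary2 Y2 B"
proof -
  have "\<exists>i. co B i 0 \<noteq> 0"
  proof (rule ccontr)
    assume "\<not> (\<exists>i. co B i 0 \<noteq> 0)"
    then have "Y2 ^ 1 dvd B" by (intro Y2_power_dvd) auto
    then obtain B' where B: "B = Y2 ^ 1 * B'" by (rule dvdE)
    obtain \<epsilon> where \<epsilon>: "\<epsilon> > 0" "\<And>x y. norm x < \<epsilon> \<Longrightarrow> norm y < \<epsilon> \<Longrightarrow> (x, y) \<noteq> (0, 0) \<Longrightarrow>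
      \<not> (eval2 Y2 (x, y) = 0 \<and> eval2 B (x, y) = 0)"
      using assms by (auto simp: isolated_zero_def)
    have "eventually (\<lambda>\<rho>. \<rho> < \<epsilon> \<and> 0 < \<rho> \<and> evaluable \<rho> B') (at_right 0)"
      using \<epsilon>(1) by (intro eventually_conj eventually_evaluable
          eventually_at_right_less order_tendstoD(2)[OF tendsto_ident_at])
    from eventually_happens'[OF trivial_limit_at_right_real this]
    obtain \<rho> where \<rho>: "\<rho> < \<epsilon>" "\<rho> > 0" "evaluable \<rho> B'"
      by auto
    have Y: "evals (Y2 ^ 1) (of_real \<rho>, 0) (0 ^ 1)" by (rule evals_Y2_power)
    moreover have "evals B (of_real \<rho>, 0) (0 ^ 1 * eval2 B' (of_real \<rho>, 0))"
      unfolding B using \<rho> by (intro evals_mult Y) (auto simp: evaluable_def)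
    ultimately show False
      using \<epsilon>(2)[of "of_real \<rho>" 0] \<rho> by (auto dest!: evals_eval2)
  qed
  then obtain n U T where U: "U dvd 1" "B = U * (X2 ^ n + Y2 * T)"
    using X_regular_factor by blast
  obtain U' where U': "1 = U * U'" using U(1) by (rule dvdE)
  have "B * U' = (U * U') * (X2 ^ n + Y2 * T)" unfolding U(2) by (simp add: mult_ac)
  then have "X2 ^ n = Y2 * (- T) + B * U'" by (simp flip: U')
  then have "X2 ^ n \<in> idl.span {Y2, B}" by (rule span_pairI)
  moreover have "Y2 ^ 1 \<in> idl.span {Y2, B}" by (simp add: idl.span_base)
  ultimately show ?thesis by (rule primary2I)
qed

lemma isolated_zero_primary2_left:
  assumes iso: "isolated_zero A B" and "A \<noteq> 0"
  shows "primary2 A B"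
proof -
  obtain s n U T where U: "U dvd 1" and A: "A = Y2 ^ s * (U * (X2 ^ n + Y2 * T))"
    using weierstrass_factor[OF \<open>A \<noteq> 0\<close>] by blast
  define W where "W = X2 ^ n + Y2 * T"
  have "isolated_zero W B" by (rule isolated_zero_factor[OF iso, of _ "Y2 ^ s * U"]) (simp add: A W_def mult_ac)
  then obtain M where M: "Y2 ^ M \<in> idl.span {W, B}"
    using weierstrass_nullstellensatz[of n T B] by (auto simp: W_def)
  \<comment> \<open>Since x^n = W - y T, the M-th power of x^n is congruent to (-T)^M y^M modulo
    \<open>W\<close>; the power of y in the ideal thus produces a power of x.\<close>
  obtain u where "(W + (- (Y2 * T))) ^ M = W * u + (- (Y2 * T)) ^ M" using add_power_decomp by blast
  then have "X2 ^ (n * M) = W * u + Y2 ^ M * (- T) ^ M"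
    by (simp add: W_def power_mult flip: power_mult_distrib)
  moreover have "W * u \<in> idl.span {W, B}" by (rule span_mult_left[OF idl.span_base]) simp
  moreover have "Y2 ^ M * (- T) ^ M \<in> idl.span {W, B}" by (rule span_mult_left[OF M])
  ultimately have "X2 ^ (n * M) \<in> idl.span {W, B}" by (simp add: idl.span_add)
  then have "primary2 W B" using M by (rule primary2I)
  moreover have "primary2 (Y2 ^ s) B"
  proof (cases s)
    case (Suc t)
    have "isolated_zero Y2 B"
      by (rule isolated_zero_factor[OF iso, of _ "Y2 ^ t * (U * W)"]) (simp add: A Suc W_def mult_ac)
    then show ?thesis by (intro primary2_power isolated_zero_Y2)
  qed (simp add: primary2_unit)
  ultimately show ?thesis
    unfolding A W_def[symmetric] using U by (auto intro: primary2_mult primary2_unit)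
qed

lemma isolated_zero_primary2:
  assumes iso: "isolated_zero A B"
  shows "primary2 A B"
proof (cases "A = 0")
  case True
  obtain \<epsilon> where \<epsilon>: "\<epsilon> > 0" "\<And>x y. norm x < \<epsilon> \<Longrightarrow> norm y < \<epsilon> \<Longrightarrow> (x, y) \<noteq> (0, 0) \<Longrightarrow>
      \<not> (eval2 A (x, y) = 0 \<and> eval2 B (x, y) = 0)"
    using iso by (auto simp: isolated_zero_def)
  have "B \<noteq> 0"
    using \<epsilon>(2)[of "of_real (\<epsilon> / 2)" 0] \<epsilon>(1) True evals_eval2[OF evals_0] by auto
  then show ?thesis
    using isolated_zero_primary2_left[of B A] iso isolated_zero_commute primary2_commute by blast
qed (use isolated_zero_primary2_left iso in blast)

lemma isolated_singularity_primary2: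
  assumes "isolated_singularity_form A B"
  shows "primary2 A B"
proof (rule isolated_zero_primary2)
  obtain d where d: "d > 0" "\<And>p. p \<noteq> (0, 0) \<Longrightarrow> dist p (0, 0) < d \<Longrightarrow> \<not> (eval2 A p = 0 \<and> eval2 B p = 0)"
    using assms unfolding isolated_singularity_form_def eventually_at by blast
  show "isolated_zero A B"
    unfolding isolated_zero_def
  proof (intro exI[of _ "d / 2"] conjI allI impI)
    fix x y :: complex assume *: "norm x < d / 2" "norm y < d / 2" "(x, y) \<noteq> (0, 0)"
    have "dist (x, y) (0, 0) = norm (x, y)" by (simp add: dist_norm zero_prod_def[symmetric] del: zero_prod_def)
    also have "\<dots> < d" using norm_Pair_le[of x y] * by simp
    finally show "\<not> (eval2 A (x, y) = 0 \<and> eval2 B (x, y) = 0)" using d(2) * by blast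
  qed (use d in auto)
qed

section \<open>Colengths and pencils\<close>

lemma mem_span_single: "x \<in> idl.span {a} \<longleftrightarrow> a dvd x"
  by (auto simp: idl.span_singleton dvd_def mult.commute)

text \<open>Being primary to the maximal ideal replaces the Cohen-Macaulay property: if \<open>a\<close> divides both
  \<open>x\<^sup>N z\<close> and \<open>y\<^sup>N z\<close> then \<open>a\<close> divides \<open>z\<close>, since \<open>x\<^sup>N, y\<^sup>N\<close> is a regular sequence.\<close>

lemma primary2_regular:
  assumes "primary2 a c" "a dvd c * z"
  shows "a dvd z"
proof -
  obtain N u v u' v' where X: "X2 ^ N = a * u + c * v" and Y: "Y2 ^ N = a * u' + c * v'"
    using assms(1) by (auto simp: primary2_def mem_span_pair)
  obtain y where y: "c * z = a * y" using assms(2) by (rule dvdE)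
  define s t where "s = u * z + v * y" and "t = u' * z + v' * y"
  have s: "X2 ^ N * z = a * s" and t: "Y2 ^ N * z = a * t"
    unfolding X Y s_def t_def by (simp_all add: algebra_simps y)
  show ?thesis
  proof (cases "a = 0")
    case True
    then have "X2 ^ N * z = 0" unfolding s by simp
    then show ?thesis by simp
  next
    case False
    have "a * (Y2 ^ N * s) = Y2 ^ N * (a * s)" by (simp add: mult_ac)
    also have "\<dots> = X2 ^ N * (Y2 ^ N * z)" unfolding s[symmetric] by (simp add: mult_ac)
    also have "\<dots> = a * (X2 ^ N * t)" unfolding t by (simp add: mult_ac)
    finally have eq: "Y2 ^ N * s = X2 ^ N * t" using False by simp
    have "co s i j = 0" if "i < N" for i j
      using arg_cong[OF eq, of "\<lambda>F. co F i (j + N)"] that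
      by (simp add: co_X2_power_mult co_Y2_power_mult)
    then obtain s' where "s = X2 ^ N * s'" using X2_power_dvd by (metis dvdE)
    then have "X2 ^ N * z = X2 ^ N * (a * s')" unfolding s by (simp add: mult_ac)
    then show ?thesis by simp
  qed
qed

section \<open>Finite colength and its additivity\<close>

definition finite_codim :: "conv2 set \<Rightarrow> bool" where
  "finite_codim S \<longleftrightarrow> (\<exists>n. reldim (idl.span S) n UNIV)"

lemma finite_codim_qdim: "finite_codim S \<Longrightarrow> reldim (idl.span S) (qdim S) UNIV"
  using qdim_eqI by (auto simp: finite_codim_def)

lemma finite_codim_subset: "finite_codim S \<Longrightarrow> S \<subseteq> idl.span T \<Longrightarrow> finite_codim T"
  unfolding finite_codim_def
  by (meson finite_codim_mono ideal_imp_cv_subspace idl.subspace_span span_subsetI)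

lemma qdim_span_cong: "idl.span S = idl.span T \<Longrightarrow> qdim S = qdim T"
  by (simp add: qdim_def genideal_O2)

lemma span_image_mult: "idl.span ((*) b ` S) = (*) b ` idl.span S"
proof -
  have "module_hom ((*) :: conv2 \<Rightarrow> _) (*) ((*) b)"
    by unfold_locales (simp_all add: distrib_left distrib_right mult.assoc mult.left_commute)
  then show ?thesis by (rule module_hom.span_image)
qed

lemma mulset_span: "mulset b (idl.span N) (idl.span S) = idl.span ((*) b ` S \<union> N)"
  unfolding mulset_def idl.span_Un span_image_mult by blast

text \<open>Additivity along O/(T) -> O/(a, bT) -> O/(a, b) -> 0, where the first map is
  multiplication by b. That map is injective: if b z lies in (a, bT), then b (z - t) is a multiple
  of a for some t in (T), hence so is z - t, and a lies in (T).\<close>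

lemma qdim_scaled_ideal:
  assumes fin: "finite_codim T" "finite_codim {a, b}"
    and "a \<in> idl.span T" and reg: "primary2 a b"
  shows "finite_codim (insert a ((*) b ` T))"
    "qdim (insert a ((*) b ` T)) = qdim {a, b} + qdim T"
proof -
  have *: "mulset b (idl.span {a}) (idl.span T) = idl.span (insert a ((*) b ` T))"
    using mulset_span[of b "{a}" T] by simp
  have "idl.span {1} = UNIV" by (auto simp: mem_span_single)
  then have **: "mulset b (idl.span {a}) UNIV = idl.span {a, b}"
    using mulset_span[of b "{a}" "{1}"] by (simp add: insert_commute)
  have "reldim (mulset b (idl.span {a}) (idl.span T)) (qdim T) (mulset b (idl.span {a}) UNIV)"
  proof (rule reldim_mulset[OF finite_codim_qdim[OF fin(1)]])
    show "x \<in> idl.span {a}" if "b * x \<in> idl.span {a}" for x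
      using that primary2_regular[OF reg, of x] by (simp add: mem_span_single)
    show "idl.span {a} \<subseteq> idl.span T" using assms(3) by (intro span_subsetI) simp
  qed (simp_all add: ideal_imp_cv_subspace)
  then have "reldim (idl.span (insert a ((*) b ` T))) (qdim T + qdim {a, b}) UNIV"
    unfolding * ** by (rule reldim_trans[OF finite_codim_qdim[OF fin(2)]])
  then show "finite_codim (insert a ((*) b ` T))"
    "qdim (insert a ((*) b ` T)) = qdim {a, b} + qdim T"
    using qdim_eqI by (auto simp: finite_codim_def)
qed

lemma span_pair_cong_dvd:
  assumes "p dvd G - H"
  shows "idl.span {p, G} = idl.span {p, H}"
proof -
  obtain k where k: "G - H = p * k" using assms by (rule dvdE)
  have "G = p * k + H * 1" "H = p * (- k) + G * 1"
    by (simp_all add: k[symmetric])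
  then have "G \<in> idl.span {p, H}" "H \<in> idl.span {p, G}" by (blast intro: span_pairI)+
  then show ?thesis by (intro equalityI span_subsetI) (auto intro: idl.span_base)
qed

text \<open>The case T = {a, c} of \<open>qdim_scaled_ideal\<close>, where b a is already a multiple
  of a. This is the additivity of intersection numbers.\<close>

lemma qdim_mult_finite_codim:
  assumes "primary2 a b" "finite_codim {a, b}" "finite_codim {a, c}"
  shows "finite_codim {a, b * c}" "qdim {a, b * c} = qdim {a, b} + qdim {a, c}"
proof -
  have eq: "idl.span (insert a ((*) b ` {a, c})) = idl.span {a, b * c}"
  proof (intro equalityI span_subsetI)
    have "b * a \<in> idl.span {a, b * c}" by (rule span_pairI[of _ _ b _ 0]) simp
    then show "insert a ((*) b ` {a, c}) \<subseteq> idl.span {a, b * c}" by (auto intro: idl.span_base)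
  qed (auto intro: idl.span_base)
  have a: "a \<in> idl.span {a, c}" by (simp add: idl.span_base)
  note scaled = qdim_scaled_ideal[OF assms(3,2) a assms(1)]
  show "finite_codim {a, b * c}" using scaled(1) unfolding finite_codim_def eq .
  show "qdim {a, b * c} = qdim {a, b} + qdim {a, c}" using scaled(2) qdim_span_cong[OF eq] by metis
qed

lemma finite_codim_unit: "finite_codim {a, 1}" "qdim {a, 1} = 0"
proof -
  have "x = a * 0 + 1 * x" for x by simp
  then have "idl.span {a, 1} = UNIV" using span_pairI by blast
  then have "reldim (idl.span {a, 1}) 0 UNIV" using reldim_refl[of UNIV] by simp
  then show "finite_codim {a, 1}" "qdim {a, 1} = 0"
    using qdim_eqI by (auto simp: finite_codim_def)
qed

lemma finite_codim_power:
  assumes "primary2 a b" "finite_codim {a, b}"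
  shows "finite_codim {a, b ^ n}"
  by (induction n) (use assms in \<open>auto intro: finite_codim_unit qdim_mult_finite_codim\<close>)

lemma finite_codim_maximal_ideal: "finite_codim {X2, Y2}"
proof -
  have zero: "co F 0 0 = 0" if F: "F \<in> idl.span {X2, Y2}" for F
  proof -
    obtain u v where "F = X2 * u + Y2 * v" using F by (auto simp: mem_span_pair)
    then show ?thesis by (simp add: co_X2_mult co_Y2_mult)
  qed
  have mem: "F \<in> idl.span {X2, Y2}" if F: "co F 0 0 = 0" for F
  proof -
    obtain G where G: "\<And>i j. co G i j = (if i = 0 then co F i j else 0)"
      using restrict_exists[of "\<lambda>i j. i = 0" F] by blast
    have "Y2 ^ 1 dvd G" by (rule Y2_power_dvd) (use G F in auto)
    moreover have "X2 ^ 1 dvd F - G" by (rule X2_power_dvd) (use G in auto)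
    ultimately obtain u v where "G = Y2 * v" "F - G = X2 * u" by (auto elim!: dvdE)
    then have "F = X2 * u + Y2 * v" by (simp add: algebra_simps)
    then show ?thesis by (rule span_pairI)
  qed
  have "1 \<notin> idl.span {X2, Y2}" using zero[of 1] by auto
  then have "reldim (idl.span {X2, Y2}) (Suc 0) (cline 1 (idl.span {X2, Y2}))"
    by (intro reldim_step reldim_refl)
  moreover have "F \<in> cline 1 (idl.span {X2, Y2})" for F
  proof (rule clineI[where c = "co F 0 0"])
    show "F - const2 (co F 0 0) * 1 \<in> idl.span {X2, Y2}"
      by (rule mem) (simp only: co_simps, simp)
  qed simp
  ultimately show ?thesis unfolding finite_codim_def by (metis UNIV_eq_I)
qed

text \<open>Reduces to the ideal (x^N, y^N), whose finite colength is built up from the maximal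
  ideal by raising first one generator and then the other to the power N.\<close>

lemma primary2_finite_codim:
  assumes "primary2 a b"
  shows "finite_codim {a, b}"
proof -
  obtain N where N: "X2 ^ N \<in> idl.span {a, b}" "Y2 ^ N \<in> idl.span {a, b}"
    using assms by (auto simp: primary2_def)
  have X: "primary2 X2 Y2"
    by (rule primary2I[where M = 1 and N = 1]) (auto intro: idl.span_base)
  have "finite_codim {X2, Y2 ^ N}" using X finite_codim_maximal_ideal by (rule finite_codim_power)
  then have "finite_codim {Y2 ^ N, X2}" by (simp add: insert_commute)
  moreover have "primary2 (Y2 ^ N) X2" using X by (intro primary2_power) (simp add: primary2_commute)
  ultimately have "finite_codim {Y2 ^ N, X2 ^ N}" by (intro finite_codim_power)
  then show ?thesis by (rule finite_codim_subset) (use N in auto)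
qed

lemma qdim_mult:
  assumes "primary2 a b" "primary2 a c"
  shows "qdim {a, b * c} = qdim {a, b} + qdim {a, c}"
  using assms by (intro qdim_mult_finite_codim(2) primary2_finite_codim)

lemma primary2_mult_right: "primary2 a b \<Longrightarrow> primary2 a c \<Longrightarrow> primary2 a (b * c)"
  using primary2_mult[of b a c] by (simp add: primary2_commute)

lemma primary2_prod:
  assumes "\<And>i. i \<in> S \<Longrightarrow> primary2 a (b i)"
  shows "primary2 a (\<Prod>i\<in>S. b i)"
  using assms
proof (induction S rule: infinite_finite_induct)
  case (insert x S)
  then show ?case by (simp add: primary2_mult_right)
qed (simp_all add: primary2_commute[of a] primary2_unit)

lemma qdim_prod:
  assumes "finite S" "\<And>i. i \<in> S \<Longrightarrow> primary2 a (b i)"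
  shows "qdim {a, \<Prod>i\<in>S. b i} = (\<Sum>i\<in>S. qdim {a, b i})"
  using assms
proof (induction S rule: finite_induct)
  case (insert x S)
  then show ?case by (simp add: qdim_mult primary2_prod)
qed (simp add: finite_codim_unit)

section \<open>Ideals, derivations and products of pencil members\<close>

lemma span_pair_const2:
  assumes "c \<noteq> 0"
  shows "idl.span {p, const2 c * q} = idl.span {p, q}"
proof (intro equalityI span_subsetI)
  have "const2 c * q \<in> idl.span {p, q}" by (rule span_pairI[of _ _ 0 _ "const2 c"]) (simp add: mult.commute)
  moreover have "q \<in> idl.span {p, const2 c * q}"
    by (rule span_pairI[of _ _ 0 _ "const2 (inverse c)"]) (use assms in \<open>simp add: mult.commute[of _ "const2 (inverse c)"]\<close>)
  ultimately show "{p, const2 c * q} \<subseteq> idl.span {p, q}" "{p, q} \<subseteq> idl.span {p, const2 c * q}"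
    by (auto intro: idl.span_base)
qed

lemma span_pencil_members:
  assumes "a * d - b * c \<noteq> 0"
  shows "idl.span {pencil_member f g a b, pencil_member f g c d} = idl.span {f, g}"
    (is "idl.span {?p, ?q} = _")
proof (intro equalityI span_subsetI)
  have "?p = f * const2 a + g * const2 b" "?q = f * const2 c + g * const2 d"
    by (simp_all add: pencil_member_def mult.commute)
  then have "?p \<in> idl.span {f, g}" "?q \<in> idl.span {f, g}" by (blast intro: span_pairI)+
  then show "{?p, ?q} \<subseteq> idl.span {f, g}" by blast
  \<comment> \<open>The inverse of the determinant; the two combinations below are Cramer's
    rule.\<close>
  define e where "e = const2 (inverse (a * d - b * c))"
  have e: "e * (const2 a * const2 d - const2 b * const2 c) = 1"
    using const2_inverse[OF assms] by (simp add: e_def const2_diff const2_mult)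
  have "?p * (e * const2 d) + ?q * (- e * const2 b) = f * (e * (const2 a * const2 d - const2 b * const2 c))"
    "?p * (- e * const2 c) + ?q * (e * const2 a) = g * (e * (const2 a * const2 d - const2 b * const2 c))"
    by (simp_all add: pencil_member_def algebra_simps)
  then have "f = ?p * (e * const2 d) + ?q * (- e * const2 b)"
    "g = ?p * (- e * const2 c) + ?q * (e * const2 a)"
    unfolding e by simp_all
  then have "f \<in> idl.span {?p, ?q}" "g \<in> idl.span {?p, ?q}" by (blast intro: span_pairI)+
  then show "{f, g} \<subseteq> idl.span {?p, ?q}" by blast
qed

lemma deriv_x_simps:
  "deriv_x (F + G) = deriv_x F + deriv_x G"
  "deriv_x (F * G) = deriv_x F * G + F * deriv_x G"
  "deriv_x (const2 c) = 0"
  by (transfer; simp add: dx_def algebra_simps)+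

lemma deriv_y_simps:
  "deriv_y (F + G) = deriv_y F + deriv_y G"
  "deriv_y (F * G) = deriv_y F * G + F * deriv_y G"
  "deriv_y (const2 c) = 0"
proof -
  have d: "fps_deriv (sum h A) = (\<Sum>i\<in>A. fps_deriv (h i))" for h :: "nat \<Rightarrow> complex fps" and A
    by (induction A rule: infinite_finite_induct) auto
  show "deriv_y (F * G) = deriv_y F * G + F * deriv_y G"
    by transfer (rule fps_ext, simp add: dy_def fps_mult_nth d sum.distrib add.commute)
qed (transfer; simp add: dy_def fps_eq_iff fps_const_def)+

text \<open>One proof of the pencil identity then serves both partial derivatives, that is, both
  coefficients of the form.\<close>

locale derivation =
  fixes D :: "conv2 \<Rightarrow> conv2"
  assumes D_add: "D (F + G) = D F + D G"
    and D_mult: "D (F * G) = D F * G + F * D G"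
    and D_const: "D (const2 c) = 0"
begin

lemma D_pencil_member: "D (pencil_member f g a b) = const2 a * D f + const2 b * D g"
  by (simp add: pencil_member_def D_add D_mult D_const)

end

interpretation dx: derivation deriv_x
  by unfold_locales (rule deriv_x_simps)+

interpretation dy: derivation deriv_y
  by unfold_locales (rule deriv_y_simps)+

text \<open>The Leibniz formula for the product of the p_i, with u_i in the role of the derivative
  of p_i. For u_i = t a_i - s b_i it is the derivative of the product, read as a form in f and g,
  along the vector (t, -s), which annihilates s f + t g.\<close>

definition cofactor_sum :: "('i \<Rightarrow> 'a::comm_ring_1) \<Rightarrow> ('i \<Rightarrow> 'a) \<Rightarrow> 'i set \<Rightarrow> 'a" where
  "cofactor_sum u p S = (\<Sum>i\<in>S. u i * (\<Prod>j\<in>S - {i}. p j))"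

lemma cofactor_sum_insert:
  assumes "finite S" "x \<notin> S"
  shows "cofactor_sum u p (insert x S) = u x * (\<Prod>j\<in>S. p j) + p x * cofactor_sum u p S"
proof -
  have "(\<Prod>j\<in>insert x S - {i}. p j) = p x * (\<Prod>j\<in>S - {i}. p j)" if "i \<in> S" for i
  proof -
    have "insert x S - {i} = insert x (S - {i})" using that assms by auto
    then show ?thesis using assms by simp
  qed
  then have "(\<Sum>i\<in>S. u i * (\<Prod>j\<in>insert x S - {i}. p j)) = p x * cofactor_sum u p S"
    by (simp add: cofactor_sum_def sum_distrib_left mult_ac)
  moreover have "insert x S - {x} = S" using assms by auto
  ultimately show ?thesis using assms by (simp add: cofactor_sum_def)
qed

text \<open>On the curve \<open>\<Prod>p\<^sub>i = 0\<close> the forms \<open>l d(\<Prod>p\<^sub>i)\<close> and \<open>g df - f dg\<close> are proportional, the factor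
  being the derivative of \<open>\<Prod>p\<^sub>i\<close> in a direction of the pencil.\<close>

lemma (in derivation) pencil_identity:
  fixes f g :: conv2 and a b :: "'i \<Rightarrow> complex" and s t :: complex
  assumes "finite S"
  defines "p \<equiv> \<lambda>i. pencil_member f g (a i) (b i)"
  defines "l \<equiv> pencil_member f g s t"
  shows "l * D (\<Prod>i\<in>S. p i) =
     cofactor_sum (\<lambda>i. const2 (t * a i - s * b i)) p S * (g * D f - f * D g)
       + of_nat (card S) * D l * (\<Prod>i\<in>S. p i)"
  using assms(1)
proof (induction S rule: finite_induct)
  case empty
  then show ?case using D_const[of 1] by (simp add: cofactor_sum_def)
next
  case (insert x S)
  let ?P = "\<Prod>i\<in>S. p i" and ?w = "g * D f - f * D g"
  let ?G = "cofactor_sum (\<lambda>i. const2 (t * a i - s * b i)) p S"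
  \<comment> \<open>The case of a single member. The coefficient of the form is, up to sign, the
    determinant of \<open>l\<close> and that member, so it vanishes only if the two are
    proportional.\<close>
  have 1: "l * D (p x) = const2 (t * a x - s * b x) * ?w + D l * p x"
    unfolding p_def l_def D_pencil_member
    by (simp add: pencil_member_def const2_diff const2_mult algebra_simps)
  have "l * D (\<Prod>i\<in>insert x S. p i) = (l * D (p x)) * ?P + p x * (l * D ?P)"
    using insert by (simp add: D_mult algebra_simps)
  also have "\<dots> = (const2 (t * a x - s * b x) * ?P + p x * ?G) * ?w + of_nat (card S + 1) * D l * (p x * ?P)"
    unfolding 1 insert.IH by (simp add: algebra_simps)
  finally show ?case
    using insert by (simp add: cofactor_sum_insert)
qed

lemma dvd_cofactor_sum:
  assumes "finite S" "i \<in> S"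
  shows "p i dvd cofactor_sum u p S - u i * (\<Prod>j\<in>S - {i}. p j)"
  using cofactor_sum_insert[of "S - {i}" i u p] assms by (simp add: insert_absorb)

lemma primary2_pencil_generators:
  assumes "primary2 (omega_x f g) (omega_y f g)"
  shows "primary2 f g"
proof (rule primary2_mono[OF assms])
  have "omega_x f g \<in> idl.span {f, g}"
    by (rule span_pairI[of _ _ "- deriv_x g" _ "deriv_x f"]) (simp add: omega_x_def)
  moreover have "omega_y f g \<in> idl.span {f, g}"
    by (rule span_pairI[of _ _ "- deriv_y g" _ "deriv_y f"]) (simp add: omega_y_def)
  ultimately show "{omega_x f g, omega_y f g} \<subseteq> idl.span {f, g}" by simp
qed

lemma pencil_members_intersection:
  assumes "primary2 f g" "a * d - b * c \<noteq> 0"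
  shows "primary2 (pencil_member f g a b) (pencil_member f g c d)"
    "qdim {pencil_member f g a b, pencil_member f g c d} = intersection_number f g"
  using assms(1) span_pencil_members[OF assms(2)] qdim_span_cong[OF span_pencil_members[OF assms(2)]]
  by (simp_all add: primary2_def intersection_number_def)

text \<open>All terms are moved to the side where they are positive, to stay within the natural
  numbers. The truncated \<open>card S - 1\<close> matters only for empty \<open>S\<close>, where
  its factor \<open>card S\<close> is 0.\<close>

lemma foliation_tjurina_pencil_product:
  fixes f g :: conv2 and a b :: "'i \<Rightarrow> complex"
  assumes prim: "primary2 (omega_x f g) (omega_y f g)"
    and fin: "finite S"
    and nz: "\<And>i. i \<in> S \<Longrightarrow> (a i, b i) \<noteq> (0, 0)"
    and distinct: "\<And>i j. i \<in> S \<Longrightarrow> j \<in> S \<Longrightarrow> i \<noteq> j \<Longrightarrow> a i * b j - b i * a j \<noteq> 0"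
  defines "P \<equiv> \<Prod>i\<in>S. pencil_member f g (a i) (b i)"
  shows "tjurina_foliation f g P + card S * (card S - 1) * intersection_number f g
       = tjurina P + card S * intersection_number f g"
proof -
  define p where "p i = pencil_member f g (a i) (b i)" for i
  have P: "P = (\<Prod>i\<in>S. p i)" by (simp add: P_def p_def)
  let ?I = "intersection_number f g"
  \<comment> \<open>The auxiliary member is f + t g with t outside finitely many slopes. For
    \<open>a i = 0\<close> the quotient is 0 by convention, which merely excludes t = 0; the
    required inequality then comes from \<open>b i \<noteq> 0\<close>.\<close>
  have "\<exists>t. t \<notin> (\<lambda>i. b i / a i) ` S"
    using fin infinite_UNIV_char_0 by (intro ex_new_if_finite) auto
  then obtain t where t: "\<And>i. i \<in> S \<Longrightarrow> t \<noteq> b i / a i" by blast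
  define l where "l = pencil_member f g 1 t"
  define c where "c i = t * a i - 1 * b i" for i
  have c: "c i \<noteq> 0" if "i \<in> S" for i
    using t[OF that] nz[OF that] by (cases "a i = 0") (auto simp: c_def field_simps)
  define G where "G = cofactor_sum (\<lambda>i. const2 (c i)) p S"
  note fg = primary2_pencil_generators[OF prim]
  have pp: "primary2 (p i) (p j)" "qdim {p i, p j} = ?I" if "i \<in> S" "j \<in> S" "i \<noteq> j" for i j
    unfolding p_def by (intro pencil_members_intersection fg distinct that)+
  have lp: "primary2 l (p i)" "qdim {l, p i} = ?I" if "i \<in> S" for i
    unfolding p_def l_def using c[OF that]
    by (intro pencil_members_intersection fg; simp add: c_def)+
  have l: "primary2 l P" "qdim {l, P} = card S * ?I"
    using lp fin by (auto simp: P primary2_prod qdim_prod)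
  have cof: "primary2 (p i) (\<Prod>j\<in>S - {i}. p j)"
    "qdim {p i, \<Prod>j\<in>S - {i}. p j} = (card S - 1) * ?I" if "i \<in> S" for i
  proof -
    have *: "primary2 (p i) (p j) \<and> qdim {p i, p j} = ?I" if "j \<in> S - {i}" for j
      using pp[OF \<open>i \<in> S\<close>, of j] that by auto
    then show "primary2 (p i) (\<Prod>j\<in>S - {i}. p j)" by (intro primary2_prod) simp
    have "qdim {p i, \<Prod>j\<in>S - {i}. p j} = (\<Sum>j\<in>S - {i}. qdim {p i, p j})"
      using fin * by (intro qdim_prod) auto
    then show "qdim {p i, \<Prod>j\<in>S - {i}. p j} = (card S - 1) * ?I"
      using * fin that by simp
  qed
  have pG: "idl.span {p i, G} = idl.span {p i, \<Prod>j\<in>S - {i}. p j}" if "i \<in> S" for i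
  proof -
    have "idl.span {p i, G} = idl.span {p i, const2 (c i) * (\<Prod>j\<in>S - {i}. p j)}"
      unfolding G_def by (intro span_pair_cong_dvd dvd_cofactor_sum fin that)
    then show ?thesis using span_pair_const2[OF c[OF that]] by simp
  qed
  have G1: "primary2 G (p i)" if "i \<in> S" for i
    using cof(1)[OF that] pG[OF that] by (subst primary2_commute) (simp add: primary2_def)
  have G2: "qdim {G, p i} = (card S - 1) * ?I" if "i \<in> S" for i
    using cof(2)[OF that] qdim_span_cong[OF pG[OF that]] by (simp add: insert_commute)
  have G: "primary2 G P" "qdim {G, P} = card S * ((card S - 1) * ?I)"
    using G1 G2 fin by (auto simp: P primary2_prod qdim_prod)
  define J where "J = {omega_x f g, omega_y f g, P}"
  define T where "T = {P, deriv_x P, deriv_y P}"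
  have J: "finite_codim J"
    by (rule finite_codim_subset[OF primary2_finite_codim[OF prim]]) (auto simp: J_def intro: idl.span_base)
  have codim: "finite_codim {P, G}" "finite_codim {P, l}" "primary2 P G" "primary2 P l"
    using l G primary2_finite_codim by (auto simp: primary2_commute)
  have dx: "l * deriv_x P = G * omega_x f g + of_nat (card S) * deriv_x l * P"
    using dx.pencil_identity[OF fin, of f g 1 t a b] by (simp add: P_def p_def[abs_def] l_def G_def c_def[abs_def] omega_x_def)
  have dy: "l * deriv_y P = G * omega_y f g + of_nat (card S) * deriv_y l * P"
    using dy.pencil_identity[OF fin, of f g 1 t a b] by (simp add: P_def p_def[abs_def] l_def G_def c_def[abs_def] omega_y_def)
  have eq: "idl.span (insert P ((*) G ` J)) = idl.span (insert P ((*) l ` T))" (is "idl.span ?A = idl.span ?B")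
  proof (intro equalityI span_subsetI)
    have PA: "x * P \<in> idl.span ?A" "x * P \<in> idl.span ?B" for x
      by (rule idl.span_scale, rule idl.span_base, simp)+
    have "l * deriv_x P \<in> idl.span ?A" "l * deriv_y P \<in> idl.span ?A"
      unfolding dx dy by (rule idl.span_add[OF idl.span_base PA(1)], simp add: J_def)+
    then show "?B \<subseteq> idl.span ?A" using PA(1) by (auto simp: T_def intro: idl.span_base)
    have "G * omega_x f g = l * deriv_x P - of_nat (card S) * deriv_x l * P"
      "G * omega_y f g = l * deriv_y P - of_nat (card S) * deriv_y l * P"
      by (simp_all add: dx dy)
    moreover have "l * deriv_x P - of_nat (card S) * deriv_x l * P \<in> idl.span ?B"
      "l * deriv_y P - of_nat (card S) * deriv_y l * P \<in> idl.span ?B"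
      by (rule idl.span_diff[OF idl.span_base PA(2)], simp add: T_def)+
    ultimately have "G * omega_x f g \<in> idl.span ?B" "G * omega_y f g \<in> idl.span ?B" by simp_all
    then show "?A \<subseteq> idl.span ?B" using PA(2) by (auto simp: J_def intro: idl.span_base)
  qed
  have GJ: "finite_codim ?A" "qdim ?A = qdim {P, G} + qdim J"
    by (rule qdim_scaled_ideal; use J codim in \<open>auto simp: J_def intro: idl.span_base\<close>)+
  \<comment> \<open>Here finiteness reaches the Tjurina ideal of \<open>P\<close>: \<open>J\<close>
    contains the coefficients of the form, scaling by \<open>G\<close> and the equality of ideals
    pass finiteness to \<open>?B\<close>, and the ideal of \<open>T\<close> contains
    \<open>?B\<close>.\<close>
  have "finite_codim ?B" using GJ(1) eq by (simp add: finite_codim_def)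
  then have T: "finite_codim T"
    by (rule finite_codim_subset) (auto simp: T_def intro!: idl.span_scale intro: idl.span_base)
  have "qdim ?B = qdim {P, l} + qdim T"
    by (rule qdim_scaled_ideal(2); use T codim in \<open>auto simp: T_def intro: idl.span_base\<close>)
  then have "qdim {P, G} + qdim J = qdim {P, l} + qdim T"
    using GJ(2) qdim_span_cong[OF eq] by simp
  then show ?thesis
    using l(2) G(2) by (simp add: J_def T_def tjurina_foliation_def tjurina_def insert_commute[of _ P] mult.assoc)
qed

section \<open>Points of the projective line and assembly of the formula\<close>

lemma proj_pt_eqI:
  assumes "(a, b) \<noteq> (0, 0)" "(c, d) \<noteq> (0, 0)" "a * d - b * c = 0"
  shows "proj_pt a b = proj_pt c d"
proof -
  have "\<exists>s. s \<noteq> 0 \<and> c = s * a \<and> d = s * b"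
  proof (cases "a = 0")
    case True
    then have "b \<noteq> 0" "c = 0" "d \<noteq> 0" using assms by auto
    then show ?thesis using True by (intro exI[of _ "d / b"]) auto
  next
    case False
    then have "d = c / a * b" using assms by (simp add: field_simps)
    moreover have "c \<noteq> 0" using assms(2) calculation by auto
    ultimately show ?thesis using False by (intro exI[of _ "c / a"]) auto
  qed
  then obtain s where s: "s \<noteq> 0" "c = s * a" "d = s * b" by blast
  have "proj_pt a b = {(t * a, t * b) | t. t \<noteq> 0}" "proj_pt c d = {(t * c, t * d) | t. t \<noteq> 0}"
    using assms by (auto simp: proj_pt_def proj_rel_def)
  moreover have "{(t * a, t * b) | t. t \<noteq> 0} = {(t * c, t * d) | t. t \<noteq> 0}"
  proof (intro equalityI subsetI)
    fix x assume "x \<in> {(t * a, t * b) | t. t \<noteq> 0}"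
    then obtain t where "x = (t * a, t * b)" "t \<noteq> 0" by blast
    then have "x = ((t / s) * c, (t / s) * d)" "t / s \<noteq> 0" using s by auto
    then show "x \<in> {(t * c, t * d) | t. t \<noteq> 0}" by blast
  next
    fix x assume "x \<in> {(t * c, t * d) | t. t \<noteq> 0}"
    then obtain t where "x = ((t * s) * a, (t * s) * b)" "t * s \<noteq> 0" using s by (auto simp: mult_ac)
    then show "x \<in> {(t * a, t * b) | t. t \<noteq> 0}" by blast
  qed
  ultimately show ?thesis by simp
qed

lemma pencil_member_generators [simp]: "pencil_member f g 1 0 = f" "pencil_member f g 0 1 = g"
  by (simp_all add: pencil_member_def)

lemma proj_pt_det_nonzero:
  assumes "(a, b) \<noteq> (0, 0)" "(c, d) \<noteq> (0, 0)" "proj_pt a b \<noteq> proj_pt c d"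
  shows "a * d - b * c \<noteq> 0"
  using assms proj_pt_eqI by blast

lemma Theta_Cons_pair: "Theta [F, G] = int (tjurina (F * G)) - int (tjurina F) - int (tjurina G) - int (intersection_number F G)"
  by (simp add: Theta_def numeral_2_eq_2)

text \<open>The sum over pairs is left unevaluated: it is the same for the r bifurcation fibers and
  for the r chosen generic fibers, so it cancels.\<close>

lemma Theta_pencil_members:
  assumes "\<And>i j. i < j \<Longrightarrow> j < r \<Longrightarrow> intersection_number (p i) (p j) = n"
  shows "Theta (map p [0..<r]) =
    int (tjurina (\<Prod>i<r. p i)) - (\<Sum>j<r. int (tjurina (p j))) - (\<Sum>j<r. int j * int n)"
proof -
  have "(\<Sum>j<r. \<Sum>i<j. int (intersection_number (p i) (p j))) = (\<Sum>j<r. int j * int n)"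
    by (intro sum.cong refl) (simp add: assms)
  moreover have "prod_list (map p [0..<r]) = (\<Prod>i<r. p i)"
    using prod.distinct_set_conv_list[of "[0..<r]" p] by (simp add: atLeast0LessThan)
  ultimately show ?thesis by (simp add: Theta_def)
qed

theorem theorem3p4:
  fixes f g :: conv2
    and r :: nat
    and \<alpha> \<beta> \<gamma> \<delta> :: "nat \<Rightarrow> complex"
    and h \<phi> :: "nat \<Rightarrow> conv2"
  assumes "coprime f g"
    and "eval2 f (0, 0) = 0" and "eval2 g (0, 0) = 0"
    and "isolated_singularity_form (omega_x f g) (omega_y f g)"
    and "\<And>i. i < r \<Longrightarrow> (\<alpha> i, \<beta> i) \<noteq> (0, 0)"
    and "\<And>i. i < r \<Longrightarrow> h i = pencil_member f g (\<alpha> i) (\<beta> i)"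
    and "bij_betw (\<lambda>i. proj_pt (\<alpha> i) (\<beta> i)) {..<r} (bifurcation_set f g)"
    and "\<And>i. i < r \<Longrightarrow> (\<gamma> i, \<delta> i) \<noteq> (0, 0)"
    and "\<And>i. i < r \<Longrightarrow> \<phi> i = pencil_member f g (\<gamma> i) (\<delta> i)"
    and "\<And>i. i < r \<Longrightarrow> proj_pt (\<gamma> i) (\<delta> i) \<notin> bifurcation_set f g"
    and "proj_pt 1 0 \<notin> bifurcation_set f g" and "proj_pt 0 1 \<notin> bifurcation_set f g"
    and "distinct (proj_pt 1 0 # proj_pt 0 1 # map (\<lambda>i. proj_pt (\<gamma> i) (\<delta> i)) [0..<r])"
  shows "int (tjurina_foliation f g (f * g * (\<Prod>i<r. h i)))
           - int (tjurina_foliation f g (\<Prod>i<r. \<phi> i))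
         = int (tjurina (f * g))
           + (\<Sum>j<r. int (tjurina (h j)) - int (tjurina (\<phi> j)))
           - 2 * int r * int (intersection_number f g)
           + Theta [f * g, \<Prod>i<r. h i]
           + Theta (map h [0..<r])
           - Theta (map \<phi> [0..<r])"
proof -
  note nzh = assms(5) and h = assms(6) and nz\<phi> = assms(8) and \<phi> = assms(9)
  let ?I = "intersection_number f g"
  define H where "H = (\<Prod>i<r. h i)"
  define \<Phi> where "\<Phi> = (\<Prod>i<r. \<phi> i)"
  have prim: "primary2 (omega_x f g) (omega_y f g)"
    using assms(4) by (rule isolated_singularity_primary2)
  note fg = primary2_pencil_generators[OF prim]
  have h_mem: "proj_pt (\<alpha> i) (\<beta> i) \<in> bifurcation_set f g" if "i < r" for i
    using bij_betwE[OF assms(7)] that by simp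
  have h_det: "\<alpha> i * \<beta> j - \<beta> i * \<alpha> j \<noteq> 0" if "i < r" "j < r" "i \<noteq> j" for i j
    using inj_onD[OF bij_betw_imp_inj_on[OF assms(7)], of i j] that
    by (intro proj_pt_det_nonzero[OF nzh nzh]) auto
  have \<phi>_det: "\<gamma> i * \<delta> j - \<delta> i * \<gamma> j \<noteq> 0" if "i < r" "j < r" "i \<noteq> j" for i j
  proof (rule proj_pt_det_nonzero[OF nz\<phi> nz\<phi>])
    have "inj_on (\<lambda>i. proj_pt (\<gamma> i) (\<delta> i)) {..<r}"
      using assms(13) by (simp add: distinct_map atLeast0LessThan)
    then show "proj_pt (\<gamma> i) (\<delta> i) \<noteq> proj_pt (\<gamma> j) (\<delta> j)"
      using inj_onD[of _ "{..<r}" i j] that by auto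
  qed (use that in auto)
  \<comment> \<open>The point [1 : 0] of f is generic and hence differs from the point of
    \<open>h i\<close>; the determinant of the two is \<open>\<beta> i\<close>. The point of g gives
    \<open>\<alpha> i\<close> in the same way.\<close>
  have \<beta>: "\<beta> i \<noteq> 0" if "i < r" for i
  proof -
    have "proj_pt 1 0 \<noteq> proj_pt (\<alpha> i) (\<beta> i)" using h_mem[OF that] assms(11) by metis
    from proj_pt_det_nonzero[OF _ nzh[OF that] this] show ?thesis by simp
  qed
  have \<alpha>: "\<alpha> i \<noteq> 0" if "i < r" for i
  proof -
    have "proj_pt 0 1 \<noteq> proj_pt (\<alpha> i) (\<beta> i)" using h_mem[OF that] assms(12) by metis
    from proj_pt_det_nonzero[OF _ nzh[OF that] this] show ?thesis by simp
  qed
  \<comment> \<open>Puts f and g at positions 0 and 1 in front of the bifurcation fibers, making one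
    family of r + 2 members.\<close>
  define a where "a i = (case i of 0 \<Rightarrow> 1 | Suc 0 \<Rightarrow> 0 | Suc (Suc k) \<Rightarrow> \<alpha> k)" for i
  define b where "b i = (case i of 0 \<Rightarrow> 0 | Suc 0 \<Rightarrow> 1 | Suc (Suc k) \<Rightarrow> \<beta> k)" for i
  have "(\<Prod>i<Suc (Suc r). pencil_member f g (a i) (b i)) = f * g * H"
    unfolding prod.lessThan_Suc_shift by (simp add: a_def b_def H_def h mult.assoc)
  then have eq1: "tjurina_foliation f g (f * g * H) + (r + 2) * (r + 1) * ?I
      = tjurina (f * g * H) + (r + 2) * ?I"
    using foliation_tjurina_pencil_product[OF prim, of "{..<Suc (Suc r)}" a b] nzh h_det \<alpha> \<beta>
    by (auto simp: a_def b_def split: nat.splits)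
  have "(\<Prod>i<r. pencil_member f g (\<gamma> i) (\<delta> i)) = \<Phi>" by (simp add: \<Phi>_def \<phi>)
  then have eq2: "tjurina_foliation f g \<Phi> + r * (r - 1) * ?I = tjurina \<Phi> + r * ?I"
    using foliation_tjurina_pencil_product[OF prim, of "{..<r}" \<gamma> \<delta>] nz\<phi> \<phi>_det by auto
  have Ih: "intersection_number (h i) (h j) = ?I" if "i < j" "j < r" for i j
    using pencil_members_intersection(2)[OF fg h_det[of i j]] that
    by (simp add: h intersection_number_def)
  have I\<phi>: "intersection_number (\<phi> i) (\<phi> j) = ?I" if "i < j" "j < r" for i j
    using pencil_members_intersection(2)[OF fg \<phi>_det[of i j]] that
    by (simp add: \<phi> intersection_number_def)
  have fgh: "primary2 (f * g) (h i) \<and> qdim {f * g, h i} = 2 * ?I" if "i < r" for i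
  proof -
    have "primary2 (h i) f" "qdim {h i, f} = ?I" "primary2 (h i) g" "qdim {h i, g} = ?I"
      using pencil_members_intersection[OF fg, of "\<alpha> i" 0 "\<beta> i" 1]
        pencil_members_intersection[OF fg, of "\<alpha> i" 1 "\<beta> i" 0] \<alpha>[OF that] \<beta>[OF that]
      by (simp_all add: h[OF that])
    then show ?thesis
      using qdim_mult[of "h i" f g] primary2_mult_right[of "h i" f g]
      by (simp add: primary2_commute[of "f * g"] insert_commute[of "f * g"])
  qed
  have "intersection_number (f * g) H = 2 * r * ?I"
    using qdim_prod[of "{..<r}" "f * g" h] fgh by (simp add: H_def intersection_number_def)
  then have T0: "Theta [f * g, H] =
      int (tjurina (f * g * H)) - int (tjurina (f * g)) - int (tjurina H) - 2 * int r * int ?I"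
    by (simp add: Theta_Cons_pair)
  have Th: "Theta (map h [0..<r]) = int (tjurina H) - (\<Sum>j<r. int (tjurina (h j))) - (\<Sum>j<r. int j * int ?I)"
    unfolding H_def by (rule Theta_pencil_members) (rule Ih)
  have T\<phi>: "Theta (map \<phi> [0..<r]) = int (tjurina \<Phi>) - (\<Sum>j<r. int (tjurina (\<phi> j))) - (\<Sum>j<r. int j * int ?I)"
    unfolding \<Phi>_def by (rule Theta_pencil_members) (rule I\<phi>)
  have 1: "int (tjurina_foliation f g (f * g * H)) = int (tjurina (f * g * H)) - (int r + 2) * int r * int ?I"
    using arg_cong[OF eq1, of int] by (simp add: algebra_simps)
  \<comment> \<open>The case distinction is for r = 0, where r - 1 is truncated but multiplied by
    r.\<close>
  have 2: "int (tjurina_foliation f g \<Phi>) = int (tjurina \<Phi>) - (int r - 2) * int r * int ?I"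
    using arg_cong[OF eq2, of int] by (cases r) (simp_all add: algebra_simps)
  \<comment> \<open>The quadratic terms contribute -(r + 2) r + r (r - 2) = -4 r times the
    intersection number. Since f g meets each \<open>h i\<close> with twice that number, the Theta
    of the two factors f g and H absorbs 2 r of it, and -2 r remains as in the claim.\<close>
  show ?thesis
    unfolding H_def[symmetric] \<Phi>_def[symmetric] T0 Th T\<phi> 1 2
    by (simp add: sum_subtractf algebra_simps)
qed

end
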